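(* For $d=1$ one has $q_L(\alpha,1,1)\gtrsim 1-\alpha$ as $\alpha\to1$ (with $\alpha<1$), and in fact $$q_L(\alpha,1,1)\sim 1-\alpha\qquad\text{as }\alpha\to1 .$$
   Context: Setting: site percolation on $\mathbb Z^{2}$ (the case $d=1$). $\Omega=\{0,1\}^{\mathbb Z^{2}}$, and for $p\in[0,1]$, $\mathbb P_p$ is the product measure on $\Omega$ of Bernoulli distributions with parameter $p$. A site $x$ is open if $\omega(x)=1$ and closed if $\omega(x)=0$. A function $F:\mathbb Z\to\mathbb Z$ is Lipschitz if $|F(x)-F(y)|\le 1$ whenever $|x-y|=1$. For $\alpha\in[0,1)$ and $\eta\in\{-1,+1\}$, $\mathsf{LIP}^{\alpha,1}_\eta$ is the event of all $\omega\in\Omega$ for which there is a Lipschitz function $F$ such that for all $x\in\mathbb Z$: $\omega((x,F(x)))=1$ and $F(x)>\lfloor\alpha\eta x\rfloor$. Critical probability: there is a number $p_L(\alpha,1,1)\in(0,1)$ (the same for $\eta=1$ and $\eta=-1$) such that $\mathbb P_p(\mathsf{LIP}^{\alpha,1}_\eta)=0$ for $p<p_L(\alpha,1,1)$ and $=1$ for $p>p_L(\alpha,1,1)$. Put $q_L(\alpha,1,1):=1-p_L(\alpha,1,1)$. Notation: $f(s)\gtrsim g(s)$ as $s\to\bar s$ means $\liminf_{s\to\bar s}f(s)/g(s)\ge1$; $f(s)\sim g(s)$ means $f(s)/g(s)\to1$. *)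

theory Defs
  imports "HOL-Probability.Probability" "HOL-Library.Landau_Symbols"
begin

type_synonym config = "int \<times> int \<Rightarrow> bool"  \<comment> \<open>\<open>True\<close> is 1 (open), \<open>False\<close> is 0 (closed)\<close>

definition perc :: "real \<Rightarrow> config measure" where
  "perc p = (\<Pi>\<^sub>M z\<in>UNIV. measure_pmf (bernoulli_pmf p))"

definition lipschitz_int :: "(int \<Rightarrow> int) \<Rightarrow> bool" where
  "lipschitz_int F \<longleftrightarrow> (\<forall>x y. \<bar>x - y\<bar> = 1 \<longrightarrow> \<bar>F x - F y\<bar> \<le> 1)"

definition LIP :: "real \<Rightarrow> int \<Rightarrow> config set" where
  "LIP \<alpha> \<eta> = {\<omega>. \<exists>F. lipschitz_int F \<and>
      (\<forall>x. \<omega> (x, F x) \<and> F x > \<lfloor>\<alpha> * of_int \<eta> * of_int x\<rfloor>)}"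

text \<open>
  The second argument \<open>pc\<close> is a critical probability for the slope \<open>\<alpha>\<close>, common to both signs \<open>\<eta>\<close>.
  Restricting to \<open>0 \<le> p \<le> 1\<close> matters: \<^const>\<open>bernoulli_pmf\<close> clamps parameters outside that range.
\<close>

definition is_critical :: "real \<Rightarrow> real \<Rightarrow> bool" where
  "is_critical \<alpha> pc \<longleftrightarrow> 0 < pc \<and> pc < 1 \<and>
     (\<forall>\<eta>\<in>{-1, 1}. \<forall>p\<in>{0..1}.
        (p < pc \<longrightarrow> measure (perc p) (LIP \<alpha> \<eta>) = 0) \<and>
        (p > pc \<longrightarrow> measure (perc p) (LIP \<alpha> \<eta>) = 1))"

definition p_L :: "real \<Rightarrow> real" where
  "p_L \<alpha> = (THE pc. is_critical \<alpha> pc)"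

definition q_L :: "real \<Rightarrow> real" where
  "q_L \<alpha> = 1 - p_L \<alpha>"

definition asymp_ge :: "real filter \<Rightarrow> (real \<Rightarrow> real) \<Rightarrow> (real \<Rightarrow> real) \<Rightarrow> bool" where
  "asymp_ge A f g \<longleftrightarrow> 1 \<le> Liminf A (\<lambda>s. ereal (f s / g s))"

end

theory Submission
  imports Defs
begin

text \<open>
  The two bounds \<open>a \<le> p_L a\<close> and, for each \<open>c < 1\<close> and all \<open>a\<close> close to 1, \<open>p_L a \<le> 1 - c * (1 - a)\<close>
  give the asymptotics. Write \<open>q = 1 - p\<close> for the density of closed sites.

  The first bound comes from a greedy walk to the east (\<open>LIP_eq_0\<close>). Started at the height of an open
  Lipschitz function it never goes below that function. It gains one unit of height at each open site that it
  meets and none at a closed site, so its speed is \<open>p\<close>, and for \<open>p < a\<close> it falls below the line.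

  For the second bound (\<open>LIP_eq_1\<close>), failure of the event is described dually: from every height over
  the origin, a walk that may step diagonally upwards to either side, and downwards from closed sites only,
  reaches the line (\<open>above_iff\<close>). If all walks went east, the greedy walk would be the best one and
  descend against the diagonal at speed about \<open>q\<close>, too slowly to reach the line when \<open>q < c * (1 - a)\<close>.
  The difficulty is to show that walks which also turn back gain nothing at first order, by a union
  bound that still knows about the open sites. The key is \<open>canonical_walk\<close>: a shortest hitting walk with the
  earliest possible falls visits distinct sites, leaves only open sites by sideways steps, and makes loops
  only with more falls than sideways steps. Hence a given walk is canonical with probability at most
  the product of a factor \<open>p\<close> for each sideways step and a factor \<open>q\<close> for each fall. Cutting a walk at its first visits to
  new columns into excursions, each with tilted weight \<open>q * z\<close> for a \<open>Fall\<close>, gives a geometric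
  series with ratio \<open>p * z powr (a - 1) * (1 + q * z + O((q * z) powr (3/2)))\<close>, where the error term accounts
  for all excursions of length at least two. For \<open>q = c * (1 - a)\<close> and \<open>z = 1 / c\<close> the ratio is below 1.

  That a critical probability exists, as the definition of \<open>p_L\<close> requires, follows from monotonicity in
  \<open>p\<close> (\<open>perc_mono\<close>), symmetry in the sign (\<open>measure_LIP_uminus\<close>) and a zero-one law (\<open>above_zero_one\<close>).
\<close>

section \<open>The percolation measure\<close>

lemma space_perc [simp]: "space (perc p) = UNIV"
  by (simp add: perc_def space_PiM PiE_def)

lemma sets_perc: "sets (perc p) = sets (\<Pi>\<^sub>M z\<in>(UNIV :: (int \<times> int) set). count_space (UNIV :: bool set))"
  unfolding perc_def by (rule sets_PiM_cong) simp_all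

lemma prob_space_perc: "prob_space (perc p)"
  unfolding perc_def by (intro prob_space_PiM prob_space_measure_pmf)

lemma measurable_perc_site [measurable]: "Measurable.pred (perc p) (\<lambda>\<omega>. \<omega> z)"
proof -
  have "(\<lambda>\<omega>. \<omega> z) \<in> measurable (perc p) (measure_pmf (bernoulli_pmf p))"
    unfolding perc_def by (rule measurable_component_singleton) simp
  thus ?thesis by simp
qed

lemma emeasure_PiM_pmf_cylinder:
  fixes r :: "'b pmf" and S :: "'i set"
  assumes "finite S"
  shows "emeasure (\<Pi>\<^sub>M i\<in>UNIV. measure_pmf r) {\<omega>. \<forall>i\<in>S. \<omega> i \<in> X i} = (\<Prod>i\<in>S. emeasure (measure_pmf r) (X i))"
proof -
  interpret product_prob_space "\<lambda>_::'i. measure_pmf r" UNIV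
    by unfold_locales
  have "{\<omega>. \<forall>i\<in>S. \<omega> i \<in> X i} = {\<omega>\<in>space (\<Pi>\<^sub>M i\<in>UNIV. measure_pmf r). \<forall>i\<in>S. \<omega> i \<in> X i}"
    by (simp add: space_PiM PiE_def)
  thus ?thesis using emeasure_PiM_Collect[of S X] assms by simp
qed

lemma distr_PiM_map_pmf:
  fixes r :: "'b pmf" and f :: "'b \<Rightarrow> 'c"
  shows "distr (\<Pi>\<^sub>M i\<in>(UNIV::'i set). measure_pmf r) (\<Pi>\<^sub>M i\<in>(UNIV::'i set). measure_pmf (map_pmf f r)) (\<lambda>\<omega>. f \<circ> \<omega>)
    = (\<Pi>\<^sub>M i\<in>(UNIV::'i set). measure_pmf (map_pmf f r))"
    and "(\<lambda>\<omega>. f \<circ> \<omega>) \<in> measurable (\<Pi>\<^sub>M i\<in>(UNIV::'i set). measure_pmf r) (\<Pi>\<^sub>M i\<in>(UNIV::'i set). measure_pmf (map_pmf f r))"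
proof -
  interpret product_prob_space "\<lambda>_::'i. measure_pmf (map_pmf f r)" UNIV
    by unfold_locales
  let ?M = "\<Pi>\<^sub>M i\<in>(UNIV::'i set). measure_pmf r" and ?N = "\<Pi>\<^sub>M i\<in>(UNIV::'i set). measure_pmf (map_pmf f r)"
  have "(\<lambda>\<omega> i. f (\<omega> i)) \<in> measurable ?M ?N"
  proof (rule measurable_PiM_single')
    fix i :: 'i
    have "(\<lambda>\<omega>. \<omega> i) \<in> measurable ?M (measure_pmf r)"
      by (rule measurable_component_singleton) simp
    hence "f \<circ> (\<lambda>\<omega>. \<omega> i) \<in> measurable ?M (measure_pmf (map_pmf f r))"
      by (rule measurable_comp) simp
    thus "(\<lambda>\<omega>. f (\<omega> i)) \<in> measurable ?M (measure_pmf (map_pmf f r))" by (simp add: comp_def)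
  qed (simp add: space_PiM PiE_def)
  thus m: "(\<lambda>\<omega>. f \<circ> \<omega>) \<in> measurable ?M ?N" by (simp add: comp_def)
  show "distr ?M ?N (\<lambda>\<omega>. f \<circ> \<omega>) = ?N"
  proof (rule PiM_eq)
    fix J :: "'i set" and F :: "'i \<Rightarrow> 'c set" assume J: "finite J"
    have e: "prod_emb UNIV (\<lambda>_. measure_pmf (map_pmf f r)) J (\<Pi>\<^sub>E j\<in>J. F j) = {\<omega>. \<forall>j\<in>J. \<omega> j \<in> F j}"
      by (auto simp: prod_emb_def PiE_iff)
    have "emeasure (distr ?M ?N (\<lambda>\<omega>. f \<circ> \<omega>)) {\<omega>. \<forall>j\<in>J. \<omega> j \<in> F j}
      = emeasure ?M {\<omega>. \<forall>j\<in>J. \<omega> j \<in> f -` F j}"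
      apply (subst emeasure_distr[OF m])
      subgoal using J unfolding e[symmetric] by (intro sets_PiM_I) auto
      by (auto intro!: arg_cong2[where f=emeasure] simp: space_PiM PiE_def)
    also have "\<dots> = (\<Prod>j\<in>J. emeasure (map_pmf f r) (F j))"
      using emeasure_PiM_pmf_cylinder[OF J, of r "\<lambda>j. f -` F j"] by simp
    finally show "emeasure (distr ?M ?N (\<lambda>\<omega>. f \<circ> \<omega>))
      (prod_emb UNIV (\<lambda>_. measure_pmf (map_pmf f r)) J (\<Pi>\<^sub>E j\<in>J. F j)) = (\<Prod>j\<in>J. emeasure (map_pmf f r) (F j))"
      by (simp add: e)
  qed simp
qed

lemma prob_pattern:
  assumes "0 \<le> p" "p \<le> 1" "distinct zs" "length bs = length zs"
  shows "measure (perc p) {\<omega>. map \<omega> zs = bs} = prod_list (map (\<lambda>b. if b then p else 1 - p) bs)"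
proof -
  have eq: "{\<omega>. map \<omega> zs = bs} = {\<omega>. \<forall>z\<in>set zs. \<omega> z \<in> {the (map_of (zip zs bs) z)}}"
  proof (intro Collect_cong iffI ballI)
    fix \<omega> z assume "map \<omega> zs = bs" "z \<in> set zs"
    thus "\<omega> z \<in> {the (map_of (zip zs bs) z)}"
      by (auto simp: map_of_zip_map)
  next
    fix \<omega> assume a: "\<forall>z\<in>set zs. \<omega> z \<in> {the (map_of (zip zs bs) z)}"
    show "map \<omega> zs = bs"
    proof (rule nth_equalityI)
      fix i assume i: "i < length (map \<omega> zs)"
      with a have "\<omega> (zs ! i) = the (map_of (zip zs bs) (zs ! i))" by simp
      also have "\<dots> = bs ! i" using i assms map_of_zip_nth[of zs bs i] by simp
      finally show "map \<omega> zs ! i = bs ! i" using i by simp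
    qed (use assms in simp)
  qed
  have "emeasure (perc p) {\<omega>. map \<omega> zs = bs} = (\<Prod>z\<in>set zs. emeasure (bernoulli_pmf p) {the (map_of (zip zs bs) z)})"
    unfolding eq perc_def by (rule emeasure_PiM_pmf_cylinder) simp
  also have "\<dots> = (\<Prod>z\<in>set zs. ennreal (if the (map_of (zip zs bs) z) then p else 1 - p))"
    using assms by (intro prod.cong) (auto simp: emeasure_pmf_single)
  also have "\<dots> = prod_list (map (\<lambda>z. ennreal (if the (map_of (zip zs bs) z) then p else 1 - p)) zs)"
    using assms by (simp add: prod.distinct_set_conv_list)
  also have "map (\<lambda>z. ennreal (if the (map_of (zip zs bs) z) then p else 1 - p)) zs = map (\<lambda>b. ennreal (if b then p else 1 - p)) bs"
    by (rule nth_equalityI) (use assms in \<open>simp_all add: map_of_zip_nth\<close>)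
  also have "prod_list \<dots> = ennreal (prod_list (map (\<lambda>b. if b then p else 1 - p) bs))"
  proof (induction bs)
    case (Cons b bs)
    have "0 \<le> (\<Prod>b\<leftarrow>bs. if b then p else 1 - p)" using assms by (intro prod_list_nonneg) auto
    thus ?case using Cons assms by (simp add: ennreal_mult)
  qed simp
  finally have "emeasure (perc p) {\<omega>. map \<omega> zs = bs} = ennreal (\<Prod>b\<leftarrow>bs. if b then p else 1 - p)" .
  moreover have "0 \<le> (\<Prod>b\<leftarrow>bs. if b then p else 1 - p)" using assms by (intro prod_list_nonneg) auto
  ultimately show ?thesis by (simp only: measure_def enn2real_ennreal)
qed

lemma sets_pattern [measurable]: "{\<omega>. map \<omega> zs = bs} \<in> sets (perc p)"
proof (cases "length bs = length zs")
  case True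
  hence "{\<omega>. map \<omega> zs = bs} = {\<omega> \<in> space (perc p). \<forall>i<length zs. \<omega> (zs ! i) = bs ! i}"
    by (auto simp: list_eq_iff_nth_eq)
  also have "\<dots> \<in> sets (perc p)" by measurable
  finally show ?thesis .
next
  case False
  hence "{\<omega>. map \<omega> zs = bs} = {}" by auto
  thus ?thesis by simp
qed

lemma perc_permute_sites:
  assumes "bij f" "E \<in> sets (perc p)"
  shows "{\<omega>. \<omega> \<circ> f \<in> E} \<in> sets (perc p)" "measure (perc p) {\<omega>. \<omega> \<circ> f \<in> E} = measure (perc p) E"
proof -
  have eq: "distr (perc p) (perc p) (\<lambda>\<omega>. \<lambda>i\<in>UNIV. \<omega> (f i)) = perc p"
    unfolding perc_def
    by (rule distr_PiM_reindex) (use assms in \<open>auto simp: prob_space_measure_pmf bij_def\<close>)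
  have "(\<lambda>\<omega>. \<lambda>i\<in>UNIV. \<omega> (f i)) \<in> measurable (perc p) (perc p)"
    unfolding perc_def by (intro measurable_restrict measurable_component_singleton) auto
  hence m: "(\<lambda>\<omega>. \<omega> \<circ> f) \<in> measurable (perc p) (perc p)" by (simp add: comp_def restrict_def)
  have eq: "distr (perc p) (perc p) (\<lambda>\<omega>. \<omega> \<circ> f) = perc p"
    using eq by (simp add: comp_def restrict_def)
  show "{\<omega>. \<omega> \<circ> f \<in> E} \<in> sets (perc p)" using measurable_sets[OF m assms(2)] by (simp add: vimage_def)
  have "measure (perc p) E = measure (distr (perc p) (perc p) (\<lambda>\<omega>. \<omega> \<circ> f)) E" by (simp add: eq)
  also have "\<dots> = measure (perc p) {\<omega>. \<omega> \<circ> f \<in> E}"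
    using m assms(2) by (simp add: measure_distr vimage_def)
  finally show "measure (perc p) {\<omega>. \<omega> \<circ> f \<in> E} = measure (perc p) E" ..
qed

text \<open>
  Monotone coupling: if \<open>p = p' * s\<close>, keep every site that is open with probability \<open>p'\<close>
  only with an additional independent probability \<open>s\<close>. The two coordinates of the coupling have the
  laws for \<open>p'\<close> and \<open>p\<close>, and the second configuration is below the first.
\<close>

lemma perc_mono:
  assumes "0 \<le> p" "p \<le> p'" "p' \<le> 1" "E \<in> sets (perc p)"
    and up: "\<And>\<omega> \<omega>'. \<omega> \<in> E \<Longrightarrow> (\<And>z. \<omega> z \<Longrightarrow> \<omega>' z) \<Longrightarrow> \<omega>' \<in> E"
  shows "measure (perc p) E \<le> measure (perc p') E"
proof (cases "p' = 0")
  case False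
  define s where "s = p / p'"
  have s: "0 \<le> s" "s \<le> 1" "p' * s = p" using assms False by (auto simp: s_def field_simps)
  define r where "r = pair_pmf (bernoulli_pmf p') (bernoulli_pmf s)"
  define K where "K = (\<Pi>\<^sub>M i\<in>(UNIV::(int\<times>int) set). measure_pmf r)"
  define g where "g = (\<lambda>(a::bool,b::bool). a \<and> b)"
  have r1: "map_pmf fst r = bernoulli_pmf p'" by (simp add: r_def map_fst_pair_pmf)
  have "map_pmf g r = bernoulli_pmf p"
  proof (rule pmf_eqI)
    fix b :: bool
    have t: "pmf (map_pmf g r) True = p"
    proof -
      have "g -` {True} = {(True,True)}" by (auto simp: g_def)
      hence "pmf (map_pmf g r) True = pmf r (True,True)" by (simp add: pmf_map measure_pmf_single)
      thus ?thesis using s assms by (simp add: r_def pmf_pair)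
    qed
    have "pmf (map_pmf g r) False = 1 - pmf (map_pmf g r) True"
      by (simp add: pmf_False_conv_True)
    thus "pmf (map_pmf g r) b = pmf (bernoulli_pmf p) b"
      using t assms by (cases b) auto
  qed
  note r2 = this
  note d = distr_PiM_map_pmf[where r=r and f=fst and 'i="int\<times>int", unfolded r1, folded perc_def K_def]
    distr_PiM_map_pmf[where r=r and f=g and 'i="int\<times>int", unfolded r2, folded perc_def K_def]
  interpret K: prob_space K unfolding K_def by (intro prob_space_PiM prob_space_measure_pmf)
  have sp: "space K = UNIV" by (simp add: K_def space_PiM PiE_def)
  have E': "E \<in> sets (perc p')" using assms sets_perc by simp
  have "measure (perc p) E = measure K {\<omega>. g \<circ> \<omega> \<in> E}"
    using measure_distr[OF d(4) assms(4)] d(3) sp by (simp add: vimage_def)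
  also have "\<dots> \<le> measure K {\<omega>. fst \<circ> \<omega> \<in> E}"
  proof (rule K.finite_measure_mono)
    show "{\<omega>. g \<circ> \<omega> \<in> E} \<subseteq> {\<omega>. fst \<circ> \<omega> \<in> E}"
      by (auto intro: up simp: g_def split_def)
    show "{\<omega>. fst \<circ> \<omega> \<in> E} \<in> sets K"
      using measurable_sets[OF d(2) E'] sp by (simp add: vimage_def)
  qed
  also have "\<dots> = measure (perc p') E"
    using measure_distr[OF d(2) E'] d(1) sp by (simp add: vimage_def)
  finally show ?thesis .
qed (use assms in auto)

text \<open>
  The hypothesis makes \<open>E\<close> a tail event, to which Kolmogorov's law applies: for each
  \<open>n\<close>, the set \<open>E\<close> is its own preimage under the map that opens the first \<open>n\<close> sites of an
  enumeration of the lattice, and this map is measurable with respect to the other sites.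
\<close>

lemma perc_zero_one:
  assumes E: "E \<in> sets (perc p)"
    and inv: "\<And>\<omega> \<omega>' S. finite S \<Longrightarrow> (\<And>z. z \<notin> S \<Longrightarrow> \<omega> z = \<omega>' z) \<Longrightarrow> \<omega> \<in> E \<Longrightarrow> \<omega>' \<in> E"
  shows "measure (perc p) E = 0 \<or> measure (perc p) E = 1"
proof -
  interpret prob_space "perc p" by (rule prob_space_perc)
  define idx where "idx = from_nat_into (UNIV :: (int \<times> int) set)"
  have bij: "bij idx" unfolding idx_def
    using bij_betw_from_nat_into[of "UNIV :: (int \<times> int) set"] by (simp add: infinite_UNIV_char_0 finite_prod)
  define A where "A = (\<lambda>n. sigma_sets UNIV {(\<lambda>\<omega>. \<omega> (idx n)) -` C |C. C \<in> (UNIV :: bool set set)} :: config set set)"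
  have sa: "sigma_algebra UNIV (A n)" for n unfolding A_def by (rule sigma_algebra_sigma_sets) auto
  let ?B = "measure_pmf (bernoulli_pmf p)"
  have "indep_vars (\<lambda>_. ?B) (\<lambda>n \<omega>. \<omega> (idx n)) (UNIV::nat set)"
  proof (rule indep_vars_iff_distr_eq_PiM[THEN iffD2])
    have "distr (perc p) ?B (\<lambda>\<omega>. \<omega> (idx n)) = ?B" for n
      unfolding perc_def by (rule distr_PiM_component) (simp_all add: prob_space_measure_pmf)
    thus "distr (perc p) (\<Pi>\<^sub>M n\<in>UNIV. ?B) (\<lambda>\<omega>. \<lambda>n\<in>UNIV. \<omega> (idx n))
      = (\<Pi>\<^sub>M n\<in>UNIV. distr (perc p) ?B (\<lambda>\<omega>. \<omega> (idx n)))"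
      unfolding perc_def
      by (simp only:) (rule distr_PiM_reindex, use bij in \<open>auto simp: prob_space_measure_pmf bij_def\<close>)
    show "(\<lambda>\<omega>. \<omega> (idx n)) \<in> measurable (perc p) ?B" for n
      unfolding perc_def by (rule measurable_component_singleton) simp
  qed simp
  hence ind: "indep_sets A UNIV" by (simp add: indep_vars_def A_def)
  have "E \<in> tail_events A"
    unfolding tail_events_def
  proof
    fix n
    define N where "N = sigma UNIV (\<Union> (A ` {n..}))"
    have sN: "space N = UNIV" "sets N = sigma_sets UNIV (\<Union> (A ` {n..}))" by (simp_all add: N_def)
    define T where "T = (\<lambda>(\<omega>::config) z. z \<in> idx ` {..<n} \<or> \<omega> z)"
    have "T \<in> measurable N (perc p)"
      unfolding T_def perc_def
    proof (rule measurable_PiM_single')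
      fix z
      obtain k where k: "z = idx k" using bij by (metis bij_pointE)
      show "(\<lambda>\<omega>. z \<in> idx ` {..<n} \<or> \<omega> z) \<in> measurable N (measure_pmf (bernoulli_pmf p))"
      proof (cases "z \<in> idx ` {..<n}")
        case False
        hence "k \<ge> n" using k by (meson imageI lessThan_iff not_less)
        have "(\<lambda>\<omega>. \<omega> z) \<in> measurable N (count_space UNIV)"
          unfolding sN measurable_def using \<open>k \<ge> n\<close>
          by (auto simp: sN k A_def intro!: sigma_sets.Basic)
        thus ?thesis using False by simp
      qed simp
    qed (simp add: sN PiE_def)
    hence "T -` E \<in> sigma_sets UNIV (\<Union> (A ` {n..}))"
      using measurable_sets[OF _ E, of T N] by (simp add: sN)
    moreover have "T -` E = E"
    proof -
      have "T \<omega> \<in> E \<longleftrightarrow> \<omega> \<in> E" for \<omega>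
        using inv[of "idx ` {..<n}" "T \<omega>" \<omega>] inv[of "idx ` {..<n}" \<omega> "T \<omega>"]
        by (auto simp: T_def)
      thus ?thesis by auto
    qed
    ultimately show "E \<in> sigma_sets (space (perc p)) (\<Union> (A ` {n..}))" by simp
  qed
  thus ?thesis using kolmogorov_0_1_law[of A E] sa ind by simp
qed

section \<open>Lipschitz functions and their dual walks\<close>

text \<open>
  Walks that certify upper bounds on an open Lipschitz function. If its graph passes at or below a
  site, then it passes at or below the two sites diagonally above that site, and if the site is closed,
  at or below the next lower site. Thus \<open>East\<close> and \<open>West\<close>
  are always permitted and go up, while \<open>Fall\<close> is permitted only at a closed site.
\<close>

datatype step = Fall | East | West

fun dx :: "step \<Rightarrow> int" where "dx Fall = 0" | "dx East = 1" | "dx West = - 1"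
fun dy :: "step \<Rightarrow> int" where "dy Fall = - 1" | "dy East = 1" | "dy West = 1"

definition disp :: "step list \<Rightarrow> int" where "disp w = sum_list (map dx w)"
definition rise :: "step list \<Rightarrow> int" where "rise w = sum_list (map dy w)"

lemma disp_simps [simp]: "disp [] = 0" "disp (s # w) = dx s + disp w" "disp (v @ w) = disp v + disp w"
  and rise_simps [simp]: "rise [] = 0" "rise (s # w) = dy s + rise w" "rise (v @ w) = rise v + rise w"
  by (simp_all add: disp_def rise_def)

definition dest :: "int \<times> int \<Rightarrow> step list \<Rightarrow> int \<times> int" where
  "dest z w = (fst z + disp w, snd z + rise w)"

definition move :: "step \<Rightarrow> int \<times> int \<Rightarrow> int \<times> int" where
  "move s z = (fst z + dx s, snd z + dy s)"

lemma dest_simps [simp]: "dest z [] = z" "dest z (s # w) = dest (move s z) w" "dest z (v @ w) = dest (dest z v) w"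
  by (simp_all add: dest_def move_def)

fun valid :: "config \<Rightarrow> int \<times> int \<Rightarrow> step list \<Rightarrow> bool" where
  "valid \<omega> z [] = True"
| "valid \<omega> z (s # w) = ((s = Fall \<longrightarrow> \<not> \<omega> z) \<and> valid \<omega> (move s z) w)"

fun sites :: "int \<times> int \<Rightarrow> step list \<Rightarrow> (int \<times> int) list" where
  "sites z [] = []"
| "sites z (s # w) = z # sites (move s z) w"

lemma valid_append: "valid \<omega> z (v @ w) \<longleftrightarrow> valid \<omega> z v \<and> valid \<omega> (dest z v) w"
  by (induction v arbitrary: z) auto

lemma length_sites [simp]: "length (sites z w) = length w"
  by (induction w arbitrary: z) auto

lemma nth_sites: "i < length w \<Longrightarrow> sites z w ! i = dest z (take i w)"
  by (induction w arbitrary: z i) (auto simp: nth_Cons' take_Cons')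

lemma valid_if_no_Fall: "Fall \<notin> set w \<Longrightarrow> valid \<omega> z w"
  by (induction w arbitrary: z) auto

text \<open>
  The event \<^const>\<open>LIP\<close> for an arbitrary lower barrier in place of a line, which makes
  vertical shifts of the barrier expressible.
\<close>

definition above :: "(int \<Rightarrow> int) \<Rightarrow> config set" where
  "above g = {\<omega>. \<exists>F. lipschitz_int F \<and> (\<forall>x. \<omega> (x, F x) \<and> F x > g x)}"

lemma valid_stays_above_lipschitz:
  assumes F: "lipschitz_int F" "\<And>x. \<omega> (x, F x)"
  shows "valid \<omega> z w \<Longrightarrow> F (fst z) \<le> snd z \<Longrightarrow> F (fst (dest z w)) \<le> snd (dest z w)"
proof (induction w arbitrary: z)
  case (Cons s w)
  have "F (fst (move s z)) \<le> snd (move s z)"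
  proof (cases s)
    case Fall
    with Cons.prems F(2)[of "fst z"] have "F (fst z) \<noteq> snd z" by auto
    thus ?thesis using Cons.prems Fall by (simp add: dest_def move_def)
  next
    case East
    have "\<bar>F (fst z + 1) - F (fst z)\<bar> \<le> 1" using F(1) by (simp add: lipschitz_int_def)
    thus ?thesis using Cons.prems East by (simp add: dest_def move_def)
  next
    case West
    have "\<bar>F (fst z + - 1) - F (fst z)\<bar> \<le> 1" using F(1) by (simp add: lipschitz_int_def)
    thus ?thesis using Cons.prems West by (simp add: dest_def move_def)
  qed
  thus ?case using Cons by simp
qed simp

lemma disp_replicate [simp]: "disp (replicate n s) = int n * dx s"
  and rise_replicate [simp]: "rise (replicate n s) = int n * dy s"
  by (induction n) (auto simp: algebra_simps)

text \<open>
  Where no walk from \<open>z\<close> reaches the barrier, each column has a lowest reachable site, and these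
  sites form the graph of the required function: it is Lipschitz because \<open>East\<close> and \<open>West\<close> are
  unrestricted, and open because a closed lowest site would allow one more \<open>Fall\<close>.
\<close>

lemma above_if_no_hitting:
  assumes "\<And>w. valid \<omega> z w \<Longrightarrow> g (fst (dest z w)) < snd (dest z w)"
  shows "\<omega> \<in> above g"
proof -
  define T where "T x = {y. \<exists>w. valid \<omega> z w \<and> dest z w = (x, y)}" for x
  have lower: "g x < y" if "y \<in> T x" for x y
    using that assms by (fastforce simp: T_def)
  have step: "y + dy s \<in> T (x + dx s)" if "y \<in> T x" "s = Fall \<longrightarrow> \<not> \<omega> (x, y)" for x y s
  proof -
    obtain w where "valid \<omega> z w" "dest z w = (x, y)" using \<open>y \<in> T x\<close> by (auto simp: T_def)
    hence "valid \<omega> z (w @ [s])" "dest z (w @ [s]) = (x + dx s, y + dy s)"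
      using that by (auto simp: valid_append) (auto simp: dest_def move_def)
    thus ?thesis unfolding T_def by blast
  qed
  have ne: "\<exists>y. y \<in> T x" for x
  proof -
    let ?w = "replicate (nat \<bar>x - fst z\<bar>) (if x \<ge> fst z then East else West)"
    have "valid \<omega> z ?w" by (rule valid_if_no_Fall) auto
    moreover have "fst (dest z ?w) = x" by (auto simp: dest_def move_def)
    ultimately have "snd (dest z ?w) \<in> T x"
      unfolding T_def by (intro CollectI exI[of _ ?w] conjI prod_eqI) simp_all
    thus ?thesis ..
  qed
  have ex: "\<exists>y\<in>T x. \<forall>y'\<in>T x. y \<le> y'" for x
  proof -
    obtain y0 where y0: "y0 \<in> T x" using ne by blast
    have "\<exists>y. y \<in> T x \<and> (\<forall>y'. y' \<in> T x \<longrightarrow> nat (y - g x) \<le> nat (y' - g x))"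
      by (rule ex_has_least_nat[of "\<lambda>y. y \<in> T x", OF y0])
    then obtain y where "y \<in> T x" "\<And>y'. y' \<in> T x \<Longrightarrow> nat (y - g x) \<le> nat (y' - g x)" by blast
    moreover have "y \<le> y'" if "nat (y - g x) \<le> nat (y' - g x)" "y' \<in> T x" for y'
      using that lower[of y' x] by linarith
    ultimately show ?thesis by blast
  qed
  then obtain F where F: "\<And>x. F x \<in> T x" "\<And>x y. y \<in> T x \<Longrightarrow> F x \<le> y" by metis
  have nb: "F (x + 1) \<le> F x + 1" "F (x - 1) \<le> F x + 1" for x
    using F(2)[OF step[of "F x" x East]] F(2)[OF step[of "F x" x West]] F(1) by simp_all
  have "lipschitz_int F"
    unfolding lipschitz_int_def
  proof (intro allI impI)
    fix x y :: int assume "\<bar>x - y\<bar> = 1"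
    hence "x = y + 1 \<or> x = y - 1" by arith
    thus "\<bar>F x - F y\<bar> \<le> 1" using nb[of y] nb[of x] by auto
  qed
  moreover have "\<omega> (x, F x)" for x
    using F(2)[OF step[of "F x" x Fall]] F(1) by fastforce
  moreover have "F x > g x" for x using lower F(1) by blast
  ultimately show ?thesis unfolding above_def by blast
qed

text \<open>
  Only countably many starting points and walks occur on the right, so this duality
  also shows that the event is measurable.
\<close>

lemma above_iff:
  "\<omega> \<in> above g \<longleftrightarrow> (\<exists>h. \<forall>w. valid \<omega> (0, h) w \<longrightarrow> g (fst (dest (0, h) w)) < snd (dest (0, h) w))"
proof
  assume "\<omega> \<in> above g"
  then obtain F where F: "lipschitz_int F" "\<And>x. \<omega> (x, F x)" "\<And>x. g x < F x" by (auto simp: above_def)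
  show "\<exists>h. \<forall>w. valid \<omega> (0, h) w \<longrightarrow> g (fst (dest (0, h) w)) < snd (dest (0, h) w)"
  proof (intro exI allI impI)
    fix w assume "valid \<omega> (0, F 0) w"
    hence "F (fst (dest (0, F 0) w)) \<le> snd (dest (0, F 0) w)"
      by (intro valid_stays_above_lipschitz) (use F in auto)
    thus "g (fst (dest (0, F 0) w)) < snd (dest (0, F 0) w)" using F(3) by (metis less_le_trans)
  qed
qed (use above_if_no_hitting in blast)

lemma measurable_valid [measurable]: "Measurable.pred (perc p) (\<lambda>\<omega>. valid \<omega> z w)"
  by (induction w arbitrary: z) (auto intro!: pred_intros_logic)

instance step :: countable by countable_datatype

lemma sets_above [measurable]: "above g \<in> sets (perc p)"
proof -
  have "{\<omega> \<in> space (perc p). \<exists>h. \<forall>w. valid \<omega> (0, h) w \<longrightarrow> g (fst (dest (0, h) w)) < snd (dest (0, h) w)} \<in> sets (perc p)"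
    by measurable
  thus ?thesis by (simp add: above_iff[symmetric])
qed

section \<open>Canonical hitting walks\<close>

text \<open>
  A walk that is not taut returns to some column without having gained depth, and the loop
  can be cut out (see \<open>canonical_walk\<close>). Since a loop with \<open>k\<close> steps \<open>West\<close> has \<open>k\<close> steps
  \<open>East\<close>, a taut walk pays for it with at least \<open>2 * k + 1\<close> falls, which is what makes
  turning back rare.
\<close>

definition taut :: "step list \<Rightarrow> bool" where
  "taut w \<longleftrightarrow> (\<forall>a v b. w = a @ v @ b \<longrightarrow> v \<noteq> [] \<longrightarrow> disp v = 0 \<longrightarrow> rise v < 0)"

lemma taut_factor: "taut (a @ v @ b) \<Longrightarrow> taut v"
proof -
  assume t: "taut (a @ v @ b)"
  have "rise u < 0" if "v = a' @ u @ b'" "u \<noteq> []" "disp u = 0" for a' u b'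
    using t[unfolded taut_def, rule_format, of "a @ a'" u "b' @ b"] that by simp
  thus "taut v" unfolding taut_def by blast
qed

lemma distinct_sites_if_taut:
  assumes "taut w" shows "distinct (sites z w)"
proof -
  have "sites z w ! i \<noteq> sites z w ! j" if "i < j" "j < length w" for i j
  proof
    assume eq: "sites z w ! i = sites z w ! j"
    define v where "v = drop i (take j w)"
    have tj: "take j w = take i w @ v" unfolding v_def using that by (metis append_take_drop_id min.absorb1 less_imp_le take_take)
    have w: "w = take i w @ v @ drop j w" using tj append_take_drop_id[of j w] by simp
    have "v \<noteq> []" using that by (simp add: v_def)
    moreover have "dest (dest z (take i w)) v = dest z (take i w)"
      using eq that tj by (simp add: nth_sites)
    hence "disp v = 0" "rise v = 0" by (auto simp: dest_def move_def prod_eq_iff)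
    ultimately show False using assms w unfolding taut_def by (metis less_irrefl)
  qed
  thus ?thesis unfolding distinct_conv_nth by (metis length_sites linorder_neqE_nat)
qed

text \<open>
  Starting lower never hurts: the lower walk copies the upper one and skips each \<open>Fall\<close> at a
  moment when it is strictly below.
\<close>

lemma lower_start:
  "valid \<omega> (x, y') w \<Longrightarrow> y \<le> y' \<Longrightarrow>
    \<exists>w'. valid \<omega> (x, y) w' \<and> length w' \<le> length w \<and> fst (dest (x, y) w') = fst (dest (x, y') w)
      \<and> snd (dest (x, y) w') \<le> snd (dest (x, y') w)"
proof (induction w arbitrary: x y y')
  case Nil
  show ?case by (rule exI[of _ "[]"]) (use Nil in simp)
next
  case (Cons s w)
  show ?case
  proof (cases "s = Fall \<and> y < y'")
    case True
    hence "valid \<omega> (x, y' - 1) w" "y \<le> y' - 1" "dest (x, y') (s # w) = dest (x, y' - 1) w"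
      using Cons.prems by (auto simp: dest_def move_def)
    with Cons.IH[of x "y' - 1" y] show ?thesis by fastforce
  next
    case False
    have "valid \<omega> (x + dx s, y' + dy s) w" "y + dy s \<le> y' + dy s"
      using Cons.prems by (auto simp: dest_def move_def)
    from Cons.IH[OF this] obtain w' where w': "valid \<omega> (x + dx s, y + dy s) w'" "length w' \<le> length w"
      "fst (dest (x + dx s, y + dy s) w') = fst (dest (x + dx s, y' + dy s) w)"
      "snd (dest (x + dx s, y + dy s) w') \<le> snd (dest (x + dx s, y' + dy s) w)" by blast
    have "s = Fall \<longrightarrow> y = y'" using False Cons.prems by auto
    hence "valid \<omega> (x, y) (s # w')" using w' Cons.prems by (auto simp: dest_def move_def)
    thus ?thesis using w' by (intro exI[of _ "s # w'"]) (auto simp: dest_def move_def)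
  qed
qed

text \<open>
  Among the walks that hit a target set, one that is shortest and, among those, performs its falls
  as early as possible reveals the state of every site that it visits. It is taut, because a loop
  without net descent can be removed by \<open>lower_start\<close>. It leaves only open sites by steps other than
  \<open>Fall\<close>: from a closed site it could take its next \<open>Fall\<close> at once, since the order of steps does not
  affect the destination. Such a later \<open>Fall\<close> exists since \<open>sideways\<close> makes the last step a \<open>Fall\<close>.
  As the sites of a taut walk are distinct, a given walk is the canonical one with at most the product
  probability of the states of its sites. The factors \<open>p\<close> for the open sites are what gives the
  sharp constant; a union bound that ignores the open sites would give a smaller one.
\<close>

lemma canonical_walk:
  fixes A :: "(int \<times> int) set"
  assumes down: "\<And>x y y'. (x, y) \<in> A \<Longrightarrow> y' \<le> y \<Longrightarrow> (x, y') \<in> A"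
    and sideways: "\<And>z s. s \<noteq> Fall \<Longrightarrow> move s z \<in> A \<Longrightarrow> z \<in> A"
    and z: "z \<notin> A" and hit: "valid \<omega> z w0" "dest z w0 \<in> A"
  shows "\<exists>w. taut w \<and> dest z w \<in> A \<and> map \<omega> (sites z w) = map (\<lambda>s. s \<noteq> Fall) w"
proof -
  define r where "r = lenlex {(Fall, East), (Fall, West)}"
  have "wf {(Fall, East), (Fall, West)}"
    by (rule wf_subset[of "Wellfounded.measure (\<lambda>s. if s = Fall then 0 else 1)"]) auto
  hence "wf r" unfolding r_def by (rule wf_lenlex)
  then obtain w where "w \<in> {w. valid \<omega> z w \<and> dest z w \<in> A}"
    and "\<And>w'. (w', w) \<in> r \<Longrightarrow> w' \<notin> {w. valid \<omega> z w \<and> dest z w \<in> A}"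
    using wfE_min[of r w0 "{w. valid \<omega> z w \<and> dest z w \<in> A}"] hit by blast
  hence w: "valid \<omega> z w" "dest z w \<in> A"
    and min: "\<And>w'. (w', w) \<in> r \<Longrightarrow> \<not> (valid \<omega> z w' \<and> dest z w' \<in> A)" by simp_all
  have short: "\<not> (valid \<omega> z w' \<and> dest z w' \<in> A)" if "length w' < length w" for w'
    using that min by (auto simp: r_def lenlex_conv)
  have "taut w"
    unfolding taut_def
  proof (intro allI impI, rule ccontr)
    fix a v b assume dec: "w = a @ v @ b" "v \<noteq> []" "disp v = 0" "\<not> rise v < 0"
    obtain x y where xy: "dest z a = (x, y)" by (cases "dest z a")
    have "dest (x, y) v = (x, y + rise v)" using dec by (simp add: dest_def move_def)
    hence "valid \<omega> (x, y + rise v) b" "dest (x, y + rise v) b \<in> A"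
      using w xy unfolding dec(1) by (auto simp: valid_append)
    from lower_start[OF this(1), of y] dec obtain b' where b': "valid \<omega> (x, y) b'" "length b' \<le> length b"
      "fst (dest (x, y) b') = fst (dest (x, y + rise v) b)"
      "snd (dest (x, y) b') \<le> snd (dest (x, y + rise v) b)" by auto
    have "dest (x, y) b' \<in> A"
      using down[of "fst (dest (x, y + rise v) b)" "snd (dest (x, y + rise v) b)" "snd (dest (x, y) b')"]
        b' \<open>dest (x, y + rise v) b \<in> A\<close> by (metis prod.collapse)
    moreover have "length (a @ b') < length w" using dec(1,2) b'(2) by (cases v) auto
    ultimately show False using short[of "a @ b'"] b'(1) w dec(1) xy by (auto simp: valid_append)
  qed
  have last: "Fall \<in> set b" if "w = a @ s # b" "s \<noteq> Fall" for a s b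
  proof (rule ccontr)
    assume nf: "Fall \<notin> set b"
    define u where "u = butlast w"
    define t where "t = last w"
    have "w \<noteq> []" using that by simp
    hence wt: "w = u @ [t]" by (simp add: u_def t_def)
    have "t \<in> set (s # b)" using that(1) last_in_set[of "s # b"] by (simp add: t_def)
    hence "t \<noteq> Fall" using that(2) nf by auto
    hence "dest z u \<in> A" using sideways[of t "dest z u"] w wt by simp
    thus False using short[of u] w wt by (simp add: valid_append)
  qed
  have "\<omega> (dest z a)" if dec: "w = a @ s # b" "s \<noteq> Fall" for a s b
  proof (rule ccontr)
    assume closed: "\<not> \<omega> (dest z a)"
    obtain c d where b: "b = c @ Fall # d" "Fall \<notin> set c"
      using last[OF dec] split_list_first by metis
    \<comment> \<open>The next fall is moved to the front, which gives an earlier word of the same length.\<close>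
    define w' where "w' = a @ Fall # s # c @ d"
    have "valid \<omega> (move Fall (dest z a)) (s # c)" using b dec by (intro valid_if_no_Fall) auto
    moreover have "dest z (a @ Fall # s # c) = dest z (a @ s # c @ [Fall])" by (simp add: dest_def move_def)
    moreover have "valid \<omega> (dest z (a @ s # c @ [Fall])) d" "valid \<omega> z a"
      using w unfolding dec b using valid_append[of \<omega> z "a @ s # c @ [Fall]" d] valid_append[of \<omega> z a] by auto
    ultimately have "valid \<omega> z w'"
      using closed valid_append[of \<omega> z "a @ Fall # s # c" d] valid_append[of \<omega> z a "Fall # s # c"]
      unfolding w'_def by auto
    moreover have "dest z w' = dest z w" by (simp add: w'_def dec b dest_def move_def)
    moreover have "(w', w) \<in> r"
    proof -
      have "(Fall, s) \<in> {(Fall, East), (Fall, West)}" using dec(2) by (cases s) auto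
      hence "\<exists>u x y v v'. w' = u @ x # v \<and> w = u @ y # v' \<and> (x, y) \<in> {(Fall, East), (Fall, West)}"
        unfolding w'_def dec(1) b(1) by blast
      moreover have "length w' = length w" by (simp add: w'_def dec b)
      ultimately show ?thesis unfolding r_def lenlex_conv lex_conv by blast
    qed
    ultimately show False using min[of w'] w(2) by auto
  qed
  hence opn: "\<omega> (sites z w ! i)" if "i < length w" "w ! i \<noteq> Fall" for i
    using that id_take_nth_drop[of i w] by (simp add: nth_sites)
  have cls: "\<not> \<omega> (sites z w ! i)" if "i < length w" "w ! i = Fall" for i
    using that id_take_nth_drop[of i w] w(1) valid_append[of \<omega> z "take i w" "Fall # drop (Suc i) w"]
    by (simp add: nth_sites)
  have "map \<omega> (sites z w) = map (\<lambda>s. s \<noteq> Fall) w"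
    by (rule nth_equalityI) (use opn cls in auto)
  thus ?thesis using \<open>taut w\<close> w by blast
qed

section \<open>Total weight of taut walks\<close>

definition weight :: "(step \<Rightarrow> real) \<Rightarrow> step list \<Rightarrow> real" where
  "weight \<phi> w = prod_list (map \<phi> w)"

lemma weight_simps [simp]:
  "weight \<phi> [] = 1" "weight \<phi> (s # w) = \<phi> s * weight \<phi> w" "weight \<phi> (v @ w) = weight \<phi> v * weight \<phi> w"
  by (simp_all add: weight_def)

lemma weight_nonneg: "(\<And>s. 0 \<le> \<phi> s) \<Longrightarrow> 0 \<le> weight \<phi> w"
  by (induction w) auto

lemma UNIV_step: "(UNIV :: step set) = {Fall, East, West}"
  using step.exhaust by auto

lemma finite_UNIV_step [simp]: "finite (UNIV :: step set)"
  by (simp add: UNIV_step)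

lemma finite_words: "finite {w :: step list. length w \<le> K}"
  using finite_lists_length_le[of "UNIV :: step set" K] by simp

definition taut_words :: "int \<Rightarrow> nat \<Rightarrow> step list set" where
  "taut_words n K = {w. taut w \<and> disp w = n \<and> length w \<le> K}"

lemma finite_taut_words [simp]: "finite (taut_words n K)"
  by (rule finite_subset[OF _ finite_words[of K]]) (auto simp: taut_words_def)

text \<open>
  Splitting before the \<open>East\<close> step that first reaches column 1: the part before it is an
  excursion, a walk with total displacement 0.
\<close>

lemma split_at_first_visit:
  "0 < disp w \<Longrightarrow> \<exists>e w'. w = e @ East # w' \<and> disp e = 0"
proof (induction w rule: rev_induct)
  case (snoc s w)
  show ?case
  proof (cases "0 < disp w")
    case True
    with snoc.IH obtain e w' where "w = e @ East # w'" "disp e = 0" by blast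
    thus ?thesis by (intro exI[of _ e] exI[of _ "w' @ [s]"]) simp
  next
    case False
    hence "s = East \<and> disp w = 0" using snoc.prems by (cases s) auto
    thus ?thesis by (intro exI[of _ w] exI[of _ "[]"]) simp
  qed
qed simp

text \<open>
  Factors of taut words are taut, so the splitting maps taut words of displacement \<open>n + 1\<close>
  injectively to pairs of a taut excursion and a taut word of displacement \<open>n\<close>.
\<close>

lemma sum_taut_words_Suc:
  assumes nn: "\<And>s. 0 \<le> \<phi> s"
  shows "(\<Sum>w\<in>taut_words (int (Suc n)) K. weight \<phi> w)
    \<le> \<phi> East * (\<Sum>w\<in>taut_words 0 K. weight \<phi> w) * (\<Sum>w\<in>taut_words (int n) K. weight \<phi> w)"
proof -
  let ?f = "\<lambda>(e, w). e @ East # w" and ?X = "taut_words 0 K \<times> taut_words (int n) K"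
  have sub: "taut_words (int (Suc n)) K \<subseteq> ?f ` ?X"
  proof
    fix w assume w: "w \<in> taut_words (int (Suc n)) K"
    then obtain e w' where e: "w = e @ East # w'" "disp e = 0"
      using split_at_first_visit[of w] by (auto simp: taut_words_def)
    have "taut e" "taut w'"
      using w e taut_factor[of "[]" e "East # w'"] taut_factor[of "e @ [East]" w' "[]"]
      by (auto simp: taut_words_def)
    hence "(e, w') \<in> ?X" using w e by (auto simp: taut_words_def)
    thus "w \<in> ?f ` ?X" using e by force
  qed
  have "(\<Sum>w\<in>taut_words (int (Suc n)) K. weight \<phi> w) \<le> (\<Sum>w\<in>?f ` ?X. weight \<phi> w)"
    by (intro sum_mono2 sub weight_nonneg nn) simp
  also have "\<dots> \<le> (\<Sum>x\<in>?X. weight \<phi> (?f x))"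
    using sum_image_le[of ?X "weight \<phi>" ?f] by (auto simp: weight_nonneg nn comp_def)
  also have "\<dots> = (\<Sum>e\<in>taut_words 0 K. \<Sum>w\<in>taut_words (int n) K. \<phi> East * weight \<phi> e * weight \<phi> w)"
    by (simp add: sum.cartesian_product split_def mult_ac)
  also have "\<dots> = \<phi> East * (\<Sum>w\<in>taut_words 0 K. weight \<phi> w) * (\<Sum>w\<in>taut_words (int n) K. weight \<phi> w)"
    by (simp add: sum_product sum_distrib_left mult_ac)
  finally show ?thesis .
qed

lemma sum_taut_words_le_power:
  assumes nn: "\<And>s. 0 \<le> \<phi> s" and S: "(\<Sum>w\<in>taut_words 0 K. weight \<phi> w) \<le> S"
  shows "(\<Sum>w\<in>taut_words (int n) K. weight \<phi> w) \<le> S * (\<phi> East * S) ^ n"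
proof (induction n)
  case (Suc n)
  have pos: "0 \<le> (\<Sum>w\<in>taut_words m K. weight \<phi> w)" for m by (intro sum_nonneg weight_nonneg nn)
  hence "0 \<le> S" using S order_trans by blast
  have "(\<Sum>w\<in>taut_words (int (Suc n)) K. weight \<phi> w)
    \<le> \<phi> East * (\<Sum>w\<in>taut_words 0 K. weight \<phi> w) * (\<Sum>w\<in>taut_words (int n) K. weight \<phi> w)"
    by (rule sum_taut_words_Suc[OF nn])
  also have "\<dots> \<le> \<phi> East * S * (S * (\<phi> East * S) ^ n)"
    using \<open>0 \<le> S\<close> nn pos by (intro mult_mono S Suc mult_nonneg_nonneg mult_left_mono) auto
  finally show ?case by (simp add: mult_ac)
qed (use S in simp)

lemma weight_eq_counts:
  "weight \<phi> w = \<phi> Fall ^ count_list w Fall * \<phi> East ^ count_list w East * \<phi> West ^ count_list w West"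
  "disp w = int (count_list w East) - int (count_list w West)"
  "rise w = int (count_list w East) + int (count_list w West) - int (count_list w Fall)"
  "length w = count_list w East + count_list w West + count_list w Fall"
proof -
  have "weight \<phi> w = \<phi> Fall ^ count_list w Fall * \<phi> East ^ count_list w East * \<phi> West ^ count_list w West
    \<and> disp w = int (count_list w East) - int (count_list w West)
    \<and> rise w = int (count_list w East) + int (count_list w West) - int (count_list w Fall)
    \<and> length w = count_list w East + count_list w West + count_list w Fall"
  proof (induction w)
    case (Cons s w)
    thus ?case by (cases s) auto
  qed simp
  thus "weight \<phi> w = \<phi> Fall ^ count_list w Fall * \<phi> East ^ count_list w East * \<phi> West ^ count_list w West"
    "disp w = int (count_list w East) - int (count_list w West)"
    "rise w = int (count_list w East) + int (count_list w West) - int (count_list w Fall)"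
    "length w = count_list w East + count_list w West + count_list w Fall" by blast+
qed

text \<open>
  In a taut excursion the falls outnumber the other steps, and the other steps come in pairs
  \<open>East\<close>, \<open>West\<close> of weight at most 1. So more than half of the letters carry the small weight \<open>y\<^sup>2\<close>.
\<close>

lemma weight_taut_excursion_le:
  assumes "taut w" "disp w = 0" "w \<noteq> []"
    and y: "\<phi> Fall = y ^ 2" "0 \<le> y" "y \<le> 1" and EW: "0 \<le> \<phi> East" "0 \<le> \<phi> West" "\<phi> East * \<phi> West \<le> 1"
  shows "weight \<phi> w \<le> y ^ (length w + 1)"
proof -
  have "rise w < 0" using assms(1)[unfolded taut_def, rule_format, of "[]" w "[]"] assms(2,3) by simp
  define u b where "u = count_list w Fall" and "b = count_list w East"
  have b: "count_list w West = b" using assms(2) weight_eq_counts(2)[of w] by (simp add: b_def)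
  have len: "length w + 1 \<le> 2 * u"
    using \<open>rise w < 0\<close> weight_eq_counts(3,4)[of w] b by (simp add: b_def u_def)
  have "weight \<phi> w = y ^ (2 * u) * (\<phi> East * \<phi> West) ^ b"
    using weight_eq_counts(1)[of \<phi> w] b y(1)
    by (simp add: u_def b_def power_mult power_mult_distrib)
  also have "\<dots> \<le> y ^ (2 * u) * 1"
    using y EW by (intro mult_left_mono power_le_one) auto
  also have "\<dots> \<le> y ^ (length w + 1)" using power_decreasing[OF len y(2,3)] by simp
  finally show ?thesis .
qed

lemma card_words: "card {w :: step list. length w = l} = 3 ^ l"
proof -
  have "card (UNIV :: step set) = 3" by (simp add: UNIV_step)
  thus ?thesis using card_lists_length_eq[of "UNIV :: step set" l] by simp
qed

text \<open>
  Up to the empty excursion and a single \<open>Fall\<close>, the excursions contribute only to third order in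
  \<open>y\<close>: there are \<open>3 ^ l\<close> words of length \<open>l\<close>, each of weight at most \<open>y ^ (l + 1)\<close>.
\<close>

lemma sum_excursions_le:
  assumes y: "\<phi> Fall = y ^ 2" "0 \<le> y" "y \<le> 1/6" and EW: "0 \<le> \<phi> East" "0 \<le> \<phi> West" "\<phi> East * \<phi> West \<le> 1"
  shows "(\<Sum>w\<in>taut_words 0 K. weight \<phi> w) \<le> 1 + y ^ 2 + 18 * y ^ 3"
proof -
  have nn: "0 \<le> \<phi> s" for s using y EW by (cases s) auto
  define L where "L = {w :: step list. 2 \<le> length w \<and> length w \<le> K}"
  have finL: "finite L" by (rule finite_subset[OF _ finite_words[of K]]) (auto simp: L_def)
  define f where "f w = (if w = [] then 1 else if w = [Fall] then y ^ 2 else y ^ (length w + 1))" for w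
  have sub: "taut_words 0 K \<subseteq> {[], [Fall]} \<union> L"
  proof
    fix w assume w: "w \<in> taut_words 0 K"
    consider "w = []" | s where "w = [s]" | "2 \<le> length w" by (cases w rule: remdups_adj.cases) auto
    thus "w \<in> {[], [Fall]} \<union> L"
    proof cases
      case 2 thus ?thesis using w by (cases s) (auto simp: taut_words_def)
    qed (use w in \<open>auto simp: L_def taut_words_def\<close>)
  qed
  have "(\<Sum>w\<in>taut_words 0 K. weight \<phi> w) \<le> (\<Sum>w\<in>taut_words 0 K. f w)"
  proof (rule sum_mono)
    fix w assume w: "w \<in> taut_words 0 K"
    show "weight \<phi> w \<le> f w"
    proof (cases "w = [] \<or> w = [Fall]")
      case False
      thus ?thesis using weight_taut_excursion_le[of w \<phi> y] w y EW by (auto simp: f_def taut_words_def)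
    qed (auto simp: f_def y)
  qed
  also have "\<dots> \<le> (\<Sum>w\<in>{[], [Fall]} \<union> L. f w)"
    using y finL by (intro sum_mono2 sub) (auto simp: f_def)
  also have "\<dots> = f [] + f [Fall] + (\<Sum>w\<in>L. f w)"
    by (subst sum.union_disjoint) (use finL in \<open>auto simp: L_def\<close>)
  also have "(\<Sum>w\<in>L. f w) = (\<Sum>w\<in>L. y ^ (length w + 1))"
    by (rule sum.cong) (auto simp: f_def L_def)
  also have "\<dots> = (\<Sum>w\<in>(\<Union>l\<in>{2..K}. {w :: step list. length w = l}). y ^ (length w + 1))"
    by (rule sum.cong) (auto simp: L_def)
  also have "\<dots> = (\<Sum>l\<in>{2..K}. \<Sum>w\<in>{w :: step list. length w = l}. y ^ (length w + 1))"
    by (rule sum.UNION_disjoint) (auto intro: finite_subset[OF _ finite_words])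
  also have "\<dots> = (\<Sum>l\<in>{2..K}. y * (3 * y) ^ l)"
    by (simp add: card_words power_mult_distrib mult_ac)
  also have "\<dots> = y * (\<Sum>l=2..K. (3 * y) ^ l)" by (simp add: sum_distrib_left)
  finally have sum: "(\<Sum>w\<in>taut_words 0 K. weight \<phi> w) \<le> f [] + f [Fall] + y * (\<Sum>l=2..K. (3 * y) ^ l)" .
  have "(\<Sum>l=2..K. (3 * y) ^ l) \<le> 18 * y ^ 2"
  proof (cases "2 \<le> K")
    case True
    have "(\<Sum>l=2..K. (3 * y) ^ l) = ((3 * y) ^ 2 - (3 * y) ^ Suc K) / (1 - 3 * y)"
      using True y by (subst sum_gp) auto
    also have "\<dots> \<le> (3 * y) ^ 2 / (1 / 2)" using y by (intro frac_le) auto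
    finally show ?thesis by (simp add: power2_eq_square)
  qed simp
  hence "y * (\<Sum>l=2..K. (3 * y) ^ l) \<le> y * (18 * y ^ 2)" using y by (intro mult_left_mono) auto
  thus ?thesis using sum by (simp add: f_def power3_eq_cube power2_eq_square)
qed

fun flip :: "step \<Rightarrow> step" where "flip Fall = Fall" | "flip East = West" | "flip West = East"

lemma flip_flip [simp]: "flip (flip s) = s"
  by (cases s) auto

lemma map_flip_flip [simp]: "map flip (map flip w) = w"
  by (simp add: comp_def)

lemma disp_map_flip [simp]: "disp (map flip w) = - disp w"
  and rise_map_flip [simp]: "rise (map flip w) = rise w"
proof -
  have "dx (flip s) = - dx s" "dy (flip s) = dy s" for s by (cases s; simp)+
  thus "disp (map flip w) = - disp w" "rise (map flip w) = rise w" by (induction w) auto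
qed

lemma taut_map_flip:
  assumes "taut w" shows "taut (map flip w)"
  unfolding taut_def
proof (intro allI impI)
  fix a v b assume "map flip w = a @ v @ b" "v \<noteq> []" "disp v = 0"
  hence "w = map flip a @ map flip v @ map flip b"
    by (metis (no_types, lifting) map_append map_flip_flip)
  thus "rise v < 0"
    using assms[unfolded taut_def, rule_format, of "map flip a" "map flip v" "map flip b"]
      \<open>v \<noteq> []\<close> \<open>disp v = 0\<close> by simp
qed

text \<open>
  The exponential tilt behind a Chernoff bound, with one factor for each step.
\<close>

lemma weight_tilt:
  fixes a z :: real
  shows "0 < z \<Longrightarrow> weight (\<lambda>s. \<psi> s * z powr (a * dx s - dy s)) w = weight \<psi> w * z powr (a * disp w - rise w)"
  by (induction w) (auto simp: algebra_simps powr_diff powr_add)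

lemma abs_disp_le_length: "\<bar>disp w\<bar> \<le> int (length w)"
  using weight_eq_counts(2,4)[of w] by simp

text \<open>
  Each word that reaches the wedge satisfies \<open>h \<le> a * \<bar>disp w\<bar> - rise w\<close>, so tilting its probability by
  \<open>z\<close> gains the factor \<open>z powr (- h)\<close>. For nonnegative displacement the tilted weights sum to a
  geometric series over the columns, of ratio \<open>r\<close>; negative displacements follow by reflection.
\<close>

lemma sum_hitting_words_le:
  assumes p: "0 \<le> p" "p \<le> 1" and z: "1 < z" and y: "(1 - p) * z = y ^ 2" "0 \<le> y" "y \<le> 1/6"
    and S: "S = 1 + y ^ 2 + 18 * y ^ 3" and r: "r = p * z powr (a - 1) * S" "r < 1"
  defines "\<psi> \<equiv> \<lambda>s. if s = Fall then 1 - p else p"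
  shows "(\<Sum>w\<in>{w. taut w \<and> length w \<le> K \<and> h + real_of_int (rise w) \<le> a * \<bar>disp w\<bar>}. weight \<psi> w)
    \<le> 2 * z powr (- h) * S / (1 - r)"
proof -
  define W where "W = {w. taut w \<and> length w \<le> K \<and> h + real_of_int (rise w) \<le> a * \<bar>disp w\<bar>}"
  define P where "P = {w \<in> W. 0 \<le> disp w}"
  define N where "N = {w \<in> W. disp w < 0}"
  have fin: "finite W" by (rule finite_subset[OF _ finite_words[of K]]) (auto simp: W_def)
  hence finP: "finite P" "finite N" by (auto simp: P_def N_def)
  have nn: "0 \<le> \<psi> s" for s using p by (simp add: \<psi>_def)
  define \<phi> where "\<phi> s = \<psi> s * z powr (a * dx s - dy s)" for s
  have nn': "0 \<le> \<phi> s" for s using nn by (simp add: \<phi>_def)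
  have "0 \<le> S" using y S by simp
  hence r0: "0 \<le> r" using p r z by simp
  have \<phi>: "\<phi> Fall = y ^ 2" "\<phi> East = p * z powr (a - 1)" using z y by (auto simp: \<phi>_def \<psi>_def powr_one)
  have EW: "\<phi> East * \<phi> West \<le> 1"
  proof -
    have "\<phi> East * \<phi> West = (p * p) * z powr (- 2)"
      using z by (simp add: \<phi>_def \<psi>_def powr_add[symmetric])
    also have "\<dots> \<le> 1"
    proof (rule mult_le_one)
      show "p * p \<le> 1" using p by (simp add: mult_le_one)
      show "z powr (- 2) \<le> 1" using z powr_mono[of "- 2" 0 z] by simp
    qed simp
    finally show ?thesis .
  qed
  have "(\<Sum>w\<in>taut_words 0 K. weight \<phi> w) \<le> S"
    unfolding S by (rule sum_excursions_le) (use \<phi>(1) y nn' EW in auto)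
  hence pow: "(\<Sum>w\<in>taut_words (int n) K. weight \<phi> w) \<le> S * r ^ n" for n
    using sum_taut_words_le_power[of \<phi> K S n] nn' by (simp add: \<phi>(2) r(1))
  have le: "weight \<psi> w \<le> z powr (- h) * weight \<phi> w" if "w \<in> P" for w
  proof -
    have "h \<le> a * disp w - rise w" using that by (auto simp: P_def W_def)
    hence "1 \<le> z powr (- h) * z powr (a * disp w - rise w)"
      using z by (simp add: powr_add[symmetric] ge_one_powr_ge_zero)
    hence "weight \<psi> w * 1 \<le> weight \<psi> w * (z powr (- h) * z powr (a * disp w - rise w))"
      by (intro mult_left_mono weight_nonneg nn)
    thus ?thesis using weight_tilt[of z \<psi> a w] z by (simp add: \<phi>_def[abs_def] mult_ac)
  qed
  have bound: "(\<Sum>w\<in>P. weight \<psi> w) \<le> z powr (- h) * S / (1 - r)"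
  proof -
    have "(\<Sum>w\<in>P. weight \<psi> w) \<le> (\<Sum>w\<in>P. z powr (- h) * weight \<phi> w)" by (rule sum_mono) (rule le)
    also have "\<dots> \<le> (\<Sum>w\<in>(\<Union>n\<in>{..K}. taut_words (int n) K). z powr (- h) * weight \<phi> w)"
    proof (rule sum_mono2)
      show "P \<subseteq> (\<Union>n\<in>{..K}. taut_words (int n) K)"
      proof
        fix w assume "w \<in> P"
        hence "w \<in> taut_words (int (nat (disp w))) K" "nat (disp w) \<le> K"
          using abs_disp_le_length[of w] by (auto simp: P_def W_def taut_words_def)
        thus "w \<in> (\<Union>n\<in>{..K}. taut_words (int n) K)" by blast
      qed
    qed (auto intro!: mult_nonneg_nonneg weight_nonneg nn')
    also have "\<dots> = (\<Sum>n\<le>K. \<Sum>w\<in>taut_words (int n) K. z powr (- h) * weight \<phi> w)"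
    proof (rule sum.UNION_disjoint)
      show "\<forall>i\<in>{..K}. \<forall>j\<in>{..K}. i \<noteq> j \<longrightarrow> taut_words (int i) K \<inter> taut_words (int j) K = {}"
        by (auto simp: taut_words_def)
    qed simp_all
    also have "\<dots> = z powr (- h) * (\<Sum>n\<le>K. \<Sum>w\<in>taut_words (int n) K. weight \<phi> w)"
      by (simp add: sum_distrib_left)
    also have "\<dots> \<le> z powr (- h) * (\<Sum>n\<le>K. S * r ^ n)"
      by (intro mult_left_mono sum_mono pow) auto
    also have "(\<Sum>n\<le>K. S * r ^ n) = S * (\<Sum>n\<le>K. r ^ n)" by (simp add: sum_distrib_left)
    also have "(\<Sum>n\<le>K. r ^ n) \<le> (\<Sum>n. r ^ n)"
      using r0 r by (intro sum_le_suminf) (auto intro: summable_geometric)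
    also have "\<dots> = 1 / (1 - r)" using r0 r by (intro suminf_geometric) auto
    finally show ?thesis using \<open>0 \<le> S\<close> by (simp add: mult_left_mono)
  qed
  have "(\<Sum>w\<in>N. weight \<psi> w) = (\<Sum>w\<in>N. weight \<psi> (map flip w))"
  proof (rule sum.cong)
    have "\<psi> (flip s) = \<psi> s" for s by (cases s) (auto simp: \<psi>_def)
    thus "weight \<psi> w = weight \<psi> (map flip w)" for w by (induction w) auto
  qed simp
  also have "\<dots> = (\<Sum>w\<in>map flip ` N. weight \<psi> w)"
    by (subst sum.reindex) (auto intro!: inj_onI simp: comp_def dest: arg_cong[of _ _ "map flip"])
  also have "\<dots> \<le> (\<Sum>w\<in>P. weight \<psi> w)"
    by (intro sum_mono2 finP weight_nonneg nn) (auto simp: P_def N_def W_def taut_map_flip)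
  finally have "(\<Sum>w\<in>N. weight \<psi> w) \<le> (\<Sum>w\<in>P. weight \<psi> w)" .
  moreover have "(\<Sum>w\<in>W. weight \<psi> w) = (\<Sum>w\<in>P. weight \<psi> w) + (\<Sum>w\<in>N. weight \<psi> w)"
    by (subst sum.union_disjoint[symmetric]) (use finP in \<open>auto simp: P_def N_def intro!: sum.cong\<close>)
  ultimately show ?thesis using bound unfolding W_def by simp
qed

section \<open>Almost sure existence\<close>

lemma LIP_eq_above: "LIP \<alpha> \<eta> = above (\<lambda>x. \<lfloor>\<alpha> * of_int \<eta> * of_int x\<rfloor>)"
  by (simp add: LIP_def above_def)

lemma sets_LIP [measurable]: "LIP \<alpha> \<eta> \<in> sets (perc p)"
  unfolding LIP_eq_above by (rule sets_above)

text \<open>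
  If the event fails, a walk from height \<open>h\<close> reaches the line of slope \<open>a\<close>, hence the wedge
  \<open>y \<le> a * \<bar>x\<bar>\<close>, and so does a canonical walk. The wedge replaces the line because it is
  symmetric and because no sideways step enters it from outside. The union bound over canonical walks
  is \<open>sum_hitting_words_le\<close>; bounding the length of the walks by \<open>K\<close> keeps all sums finite.
\<close>

lemma LIP_ge:
  assumes p: "0 \<le> p" "p \<le> 1" and z: "1 < z" and y: "(1 - p) * z = y ^ 2" "0 \<le> y" "y \<le> 1/6"
    and S: "S = 1 + y ^ 2 + 18 * y ^ 3" and r: "r = p * z powr (a - 1) * S" "r < 1"
    and a: "0 \<le> a" "a \<le> 1" and h: "0 < h"
  shows "1 - 2 * z powr (- of_int h) * S / (1 - r) \<le> measure (perc p) (LIP a 1)"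
proof -
  interpret prob_space "perc p" by (rule prob_space_perc)
  let ?\<psi> = "\<lambda>s. if s = Fall then 1 - p else p" and ?b = "2 * z powr (- of_int h) * S / (1 - r)"
  define A where "A = {v. of_int (snd v) \<le> a * \<bar>of_int (fst v)\<bar>}"
  define C where "C w = {\<omega>. map \<omega> (sites (0, h) w) = map (\<lambda>s. s \<noteq> Fall) w}" for w
  have setsC [measurable]: "C w \<in> sets (perc p)" for w
    unfolding C_def by (rule sets_pattern)
  define W where "W K = {w. taut w \<and> length w \<le> K \<and> of_int h + real_of_int (rise w) \<le> a * \<bar>disp w\<bar>}" for K
  have finW: "finite (W K)" for K by (rule finite_subset[OF _ finite_words[of K]]) (auto simp: W_def)
  define U where "U K = (\<Union>w\<in>W K. C w)" for K
  have setsU: "U K \<in> sets (perc p)" for K unfolding U_def by (intro sets.finite_UN finW setsC)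
  have "measure (perc p) (U K) \<le> ?b" for K
  proof -
    have "measure (perc p) (U K) \<le> (\<Sum>w\<in>W K. measure (perc p) (C w))"
      unfolding U_def by (rule finite_measure_subadditive_finite) (use finW in auto)
    also have "\<dots> = (\<Sum>w\<in>W K. weight ?\<psi> w)"
    proof (rule sum.cong)
      fix w assume "w \<in> W K"
      hence "distinct (sites (0, h) w)" by (intro distinct_sites_if_taut) (simp add: W_def)
      hence "measure (perc p) (C w) = prod_list (map (\<lambda>b. if b then p else 1 - p) (map (\<lambda>s. s \<noteq> Fall) w))"
        unfolding C_def using p by (intro prob_pattern) auto
      also have "\<dots> = weight ?\<psi> w"
        unfolding weight_def by (auto simp: comp_def intro!: arg_cong[of _ _ prod_list])
      finally show "measure (perc p) (C w) = weight ?\<psi> w" .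
    qed simp
    also have "\<dots> \<le> ?b" unfolding W_def using sum_hitting_words_le[OF p z y S r] by simp
    finally show ?thesis .
  qed
  moreover have "(\<lambda>K. measure (perc p) (U K)) \<longlonglongrightarrow> measure (perc p) (\<Union>K. U K)"
  proof (rule finite_Lim_measure_incseq)
    show "incseq U" by (intro incseq_SucI) (auto simp: U_def W_def)
  qed (use setsU in auto)
  ultimately have "measure (perc p) (\<Union>K. U K) \<le> ?b" by (intro LIMSEQ_le_const2) auto
  moreover have "- (\<Union>K. U K) \<subseteq> LIP a 1"
  proof (rule subsetI, rule ccontr)
    fix \<omega> assume \<omega>: "\<omega> \<in> - (\<Union>K. U K)" "\<omega> \<notin> LIP a 1"
    then obtain w where w: "valid \<omega> (0, h) w" "snd (dest (0, h) w) \<le> \<lfloor>a * fst (dest (0, h) w)\<rfloor>"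
      using above_if_no_hitting[of \<omega> "(0, h)"] by (force simp: LIP_eq_above not_less)
    have "of_int (snd (dest (0, h) w)) \<le> a * fst (dest (0, h) w)" using w(2) by (simp add: le_floor_iff)
    also have "\<dots> \<le> a * \<bar>of_int (fst (dest (0, h) w))\<bar>" using a by (intro mult_left_mono) auto
    finally have "dest (0, h) w \<in> A" by (simp add: A_def)
    have "\<exists>w. taut w \<and> dest (0, h) w \<in> A \<and> map \<omega> (sites (0, h) w) = map (\<lambda>s. s \<noteq> Fall) w"
    proof (rule canonical_walk)
      show "(x, y') \<in> A" if "(x, y) \<in> A" "y' \<le> y" for x y y'
        using that by (auto simp: A_def)
      show "v \<in> A" if "s \<noteq> Fall" "move s v \<in> A" for v s
      proof -
        have "of_int (snd v) + 1 \<le> a * \<bar>of_int (fst v) + of_int (dx s)\<bar>"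
          using that by (cases s) (auto simp: A_def move_def)
        also have "\<dots> \<le> a * (\<bar>of_int (fst v)\<bar> + 1)"
          using a by (intro mult_left_mono) (cases s, auto)
        also have "\<dots> \<le> a * \<bar>of_int (fst v)\<bar> + 1" using a by (simp add: algebra_simps)
        finally show ?thesis by (simp add: A_def)
      qed
      show "(0, h) \<notin> A" using h by (simp add: A_def)
    qed fact+
    then obtain v where "taut v" "dest (0, h) v \<in> A" "\<omega> \<in> C v" by (auto simp: C_def)
    hence "v \<in> W (length v)" by (simp add: W_def A_def dest_def)
    thus False using \<omega>(1) \<open>\<omega> \<in> C v\<close> by (auto simp: U_def)
  qed
  hence "measure (perc p) (space (perc p) - (\<Union>K. U K)) \<le> measure (perc p) (LIP a 1)"
    by (intro finite_measure_mono) auto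
  moreover have "measure (perc p) (space (perc p) - (\<Union>K. U K)) = 1 - measure (perc p) (\<Union>K. U K)"
    using setsU by (intro prob_compl) auto
  ultimately show ?thesis by linarith
qed

text \<open>
  The error term in \<open>LIP_ge\<close> decays exponentially in the height of the starting point.
\<close>

lemma LIP_eq_1:
  assumes p: "0 \<le> p" "p \<le> 1" and z: "1 < z" and y: "(1 - p) * z = y ^ 2" "0 \<le> y" "y \<le> 1/6"
    and r: "p * z powr (a - 1) * (1 + y ^ 2 + 18 * y ^ 3) < 1"
    and a: "0 \<le> a" "a \<le> 1"
  shows "measure (perc p) (LIP a 1) = 1"
proof -
  interpret prob_space "perc p" by (rule prob_space_perc)
  define S where "S = 1 + y ^ 2 + 18 * y ^ 3"
  define r where "r = p * z powr (a - 1) * S"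
  have "(\<lambda>n. 1 - 2 * (inverse z) ^ Suc n * S / (1 - r)) \<longlonglongrightarrow> 1 - 2 * 0 * S / (1 - r)"
    by (intro tendsto_intros LIMSEQ_Suc[OF LIMSEQ_power_zero]) (use z assms(7) in \<open>auto simp: r_def S_def inverse_less_1_iff\<close>)
  moreover have "1 - 2 * (inverse z) ^ Suc n * S / (1 - r) \<le> measure (perc p) (LIP a 1)" for n
  proof -
    have "z powr (- of_int (int (Suc n))) = inverse z ^ Suc n"
      using z by (simp only: of_int_of_nat_eq powr_minus powr_realpow power_inverse)
    thus ?thesis using LIP_ge[OF p z y S_def r_def _ a, of "int (Suc n)"] assms(7) by (simp add: r_def S_def)
  qed
  ultimately have "1 \<le> measure (perc p) (LIP a 1)" by (intro LIMSEQ_le_const2[of _ "1"]) auto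
  thus ?thesis using prob_le_1[of "LIP a 1"] by linarith
qed

section \<open>Almost sure failure below the slope\<close>

text \<open>
  The sites inspected by the eastward walk that goes up diagonally from an open site and
  horizontally from a closed one, when the observed states are \<open>bs\<close>. One site per column is inspected,
  so the states are independent and the height gained in \<open>n\<close> columns is binomial.
\<close>

fun greedy :: "int \<times> int \<Rightarrow> bool list \<Rightarrow> (int \<times> int) list" where
  "greedy z [] = []"
| "greedy z (b # bs) = z # greedy (fst z + 1, snd z + of_bool b) bs"

lemma length_greedy [simp]: "length (greedy z bs) = length bs"
  by (induction bs arbitrary: z) auto

lemma greedy_east: "v \<in> set (greedy z bs) \<Longrightarrow> fst z \<le> fst v"
  by (induction bs arbitrary: z) fastforce+

lemma distinct_greedy: "distinct (greedy z bs)"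
  by (induction bs arbitrary: z) (auto dest: greedy_east)

lemma greedy_exists: "\<exists>bs. length bs = n \<and> map \<omega> (greedy z bs) = bs"
proof (induction n arbitrary: z)
  case (Suc n)
  obtain bs where "length bs = n" "map \<omega> (greedy (fst z + 1, snd z + of_bool (\<omega> z)) bs) = bs"
    using Suc by blast
  thus ?case by (intro exI[of _ "\<omega> z # bs"]) simp
qed simp

lemma greedy_bounds_lipschitz:
  assumes F: "lipschitz_int F" "\<And>x. \<omega> (x, F x)"
  shows "map \<omega> (greedy z bs) = bs \<Longrightarrow> F (fst z) \<le> snd z \<Longrightarrow>
    F (fst z + int (length bs)) \<le> snd z + int (count_list bs True)"
proof (induction bs arbitrary: z)
  case (Cons b bs)
  have b: "\<omega> z = b" using Cons.prems by simp
  have "\<bar>F (fst z + 1) - F (fst z)\<bar> \<le> 1" using F(1) by (simp add: lipschitz_int_def)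
  moreover have "F (fst z) \<noteq> snd z" if "\<not> b" using F(2)[of "fst z"] b that by auto
  ultimately have "F (fst z + 1) \<le> snd z + of_bool b" using Cons.prems(2) by (cases b) auto
  hence "F (fst z + 1 + int (length bs)) \<le> snd z + of_bool b + int (count_list bs True)"
    using Cons.IH[of "(fst z + 1, snd z + of_bool b)"] Cons.prems(1) by simp
  thus ?case by (cases b) (simp_all add: algebra_simps)
qed simp

lemma finite_bit_words [simp]: "finite {bs :: bool list. length bs = n}"
  using finite_lists_length_eq[of "UNIV :: bool set" n] by simp

lemma sum_bit_words:
  "(\<Sum>bs | length bs = n. prod_list (map f bs)) = (f True + f False :: real) ^ n"
proof (induction n)
  case (Suc n)
  have "{bs :: bool list. length bs = Suc n} = (\<lambda>(b, bs). b # bs) ` (UNIV \<times> {bs. length bs = n})"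
    by (auto simp: length_Suc_conv image_iff)
  hence "(\<Sum>bs | length bs = Suc n. prod_list (map f bs))
    = (\<Sum>x\<in>UNIV \<times> {bs. length bs = n}. f (fst x) * prod_list (map f (snd x)))"
    by (simp only:) (subst sum.reindex, auto simp: inj_on_def split_def)
  also have "\<dots> = (\<Sum>b\<in>UNIV. \<Sum>bs | length bs = n. f b * prod_list (map f bs))"
    by (simp add: sum.cartesian_product split_def)
  also have "\<dots> = (\<Sum>b\<in>UNIV. f b) * (\<Sum>bs | length bs = n. prod_list (map f bs))"
    by (rule sum_product[symmetric])
  finally show ?case using Suc by (simp add: UNIV_bool add.commute)
qed simp

text \<open>
  An open Lipschitz function never exceeds the greedy walk from its own height at column 0, which
  grows with speed \<open>p\<close> only and so falls below the line of slope \<open>a\<close>. The Chernoff bound uses the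
  tilt \<open>z = a / p\<close>, for which \<open>p * (z - 1) < a * ln z\<close> is \<open>1 - 1 / z < ln z\<close>.
\<close>

lemma LIP_eq_0:
  assumes p: "0 \<le> p" "p < a" "a \<le> 1"
  shows "measure (perc p) (LIP a 1) = 0"
proof -
  interpret prob_space "perc p" by (rule prob_space_perc)
  obtain z where z: "1 < z" "p * (z - 1) < a * ln z"
  proof (cases "p = 0")
    case True
    thus ?thesis using that[of 2] p by simp
  next
    case False
    hence "1 < a / p" using p by simp
    have "ln (p / a) \<noteq> p / a - 1" using ln_eq_minus_one[of "p / a"] p False by auto
    moreover have "ln (p / a) \<le> p / a - 1" using p False by (intro ln_le_minus_one) auto
    ultimately have "1 - p / a < ln (a / p)" using p False by (simp add: ln_div)
    hence "a * (1 - p / a) < a * ln (a / p)" using p by (intro mult_strict_left_mono) auto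
    thus ?thesis using that[of "a / p"] p False \<open>1 < a / p\<close> by (simp add: algebra_simps)
  qed
  define r where "r = (1 - p + p * z) * z powr (- a)"
  have "0 \<le> r" using p z unfolding r_def by (intro mult_nonneg_nonneg add_nonneg_nonneg) auto
  have "1 - p + p * z \<le> exp (p * (z - 1))" using exp_ge_add_one_self[of "p * (z - 1)"] by (simp add: algebra_simps)
  also have "\<dots> < z powr a" using z by (simp add: powr_def)
  finally have "r < 1" using z by (simp add: r_def powr_minus field_simps)
  define X where "X h bs = {\<omega>. map \<omega> (greedy (0, h) bs) = bs}" for h bs
  have setsX [measurable]: "X h bs \<in> sets (perc p)" for h bs
    unfolding X_def by (rule sets_pattern)
  define B where "B h n = {bs. length bs = n \<and> a * n < of_int h + count_list bs True}" for h :: int and n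
  have finB: "finite (B h n)" for h n
    by (rule finite_subset[OF _ finite_bit_words[of n]]) (auto simp: B_def)
  define Y where "Y h n = (\<Union>bs\<in>B h n. X h bs)" for h n
  have setsY: "Y h n \<in> sets (perc p)" for h n
    unfolding Y_def by (intro sets.finite_UN finB setsX)
  have Y: "prob (Y h n) \<le> z powr h * r ^ n" for h :: int and n
  proof -
    let ?\<psi> = "\<lambda>b. if b then p else 1 - p" and ?f = "\<lambda>b. if b then p * z else 1 - p"
    have f: "prod_list (map ?f bs) = prod_list (map ?\<psi> bs) * z ^ count_list bs True" for bs
      by (induction bs) auto
    have nn: "0 \<le> prod_list (map ?\<psi> bs)" "0 \<le> prod_list (map ?f bs)" for bs
      using p z by (auto intro!: prod_list_nonneg)
    have "prob (Y h n) \<le> (\<Sum>bs\<in>B h n. prob (X h bs))"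
      unfolding Y_def by (rule finite_measure_subadditive_finite) (use finB in auto)
    also have "\<dots> = (\<Sum>bs\<in>B h n. prod_list (map ?\<psi> bs))"
      unfolding X_def using p by (intro sum.cong prob_pattern distinct_greedy) auto
    also have "\<dots> \<le> (\<Sum>bs\<in>B h n. z powr (h - a * n) * prod_list (map ?f bs))"
    proof (rule sum_mono)
      fix bs assume "bs \<in> B h n"
      hence "0 \<le> h - a * n + count_list bs True" by (simp add: B_def)
      hence "1 \<le> z powr (h - a * n) * z ^ count_list bs True"
        using z by (simp add: powr_realpow[symmetric] powr_add[symmetric] ge_one_powr_ge_zero)
      hence "prod_list (map ?\<psi> bs) * 1 \<le> prod_list (map ?\<psi> bs) * (z powr (h - a * n) * z ^ count_list bs True)"
        by (intro mult_left_mono nn)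
      thus "prod_list (map ?\<psi> bs) \<le> z powr (h - a * n) * prod_list (map ?f bs)"
        unfolding f by (simp add: mult_ac)
    qed
    also have "\<dots> \<le> (\<Sum>bs | length bs = n. z powr (h - a * n) * prod_list (map ?f bs))"
      by (intro sum_mono2 mult_nonneg_nonneg nn) (auto simp: B_def)
    also have "\<dots> = z powr (h - a * n) * (\<Sum>bs | length bs = n. prod_list (map ?f bs))"
      by (simp add: sum_distrib_left)
    also have "\<dots> = z powr (h - a * n) * (1 - p + p * z) ^ n"
      by (subst sum_bit_words) (simp add: add.commute)
    also have "\<dots> = z powr h * r ^ n"
      using z by (simp add: r_def power_mult_distrib powr_diff powr_minus powr_realpow[symmetric] powr_powr field_simps)
    finally show ?thesis .
  qed
  have "(\<Inter>n. Y h n) \<in> null_sets (perc p)" for h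
  proof -
    have s: "(\<Inter>n. Y h n) \<in> sets (perc p)" using setsY by auto
    have "(\<lambda>n. z powr h * r ^ n) \<longlonglongrightarrow> z powr h * 0"
      using \<open>0 \<le> r\<close> \<open>r < 1\<close> by (intro tendsto_intros LIMSEQ_power_zero) auto
    moreover have "prob (\<Inter>n. Y h n) \<le> z powr h * r ^ n" for n
      using finite_measure_mono[of "\<Inter>n. Y h n" "Y h n"] setsY Y[of h n] by force
    ultimately have "prob (\<Inter>n. Y h n) \<le> 0" by (intro LIMSEQ_le_const[where a="prob (\<Inter>n. Y h n)"]) auto
    hence "prob (\<Inter>n. Y h n) = 0" using measure_nonneg[of "perc p" "\<Inter>n. Y h n"] by linarith
    thus ?thesis using s by (simp add: null_sets_def emeasure_eq_measure)
  qed
  hence "(\<Union>h. \<Inter>n. Y h n) \<in> null_sets (perc p)" by (intro null_sets_UN) auto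
  moreover have "LIP a 1 \<subseteq> (\<Union>h. \<Inter>n. Y h n)"
  proof
    fix \<omega> assume "\<omega> \<in> LIP a 1"
    then obtain F where F: "lipschitz_int F" "\<And>x. \<omega> (x, F x)" "\<And>x. \<lfloor>a * of_int x\<rfloor> < F x"
      by (auto simp: LIP_def)
    have "\<omega> \<in> Y (F 0) n" for n
    proof -
      obtain bs where bs: "length bs = n" "map \<omega> (greedy (0, F 0) bs) = bs"
        using greedy_exists by blast
      have "F (int n) \<le> F 0 + count_list bs True"
        using greedy_bounds_lipschitz[OF F(1,2) bs(2)] bs(1) by simp
      moreover have "a * n < F (int n)" using F(3)[of "int n"] by (simp add: floor_less_iff)
      ultimately have "bs \<in> B (F 0) n" using bs(1) by (simp add: B_def)
      thus ?thesis using bs(2) by (auto simp: Y_def X_def)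
    qed
    thus "\<omega> \<in> (\<Union>h. \<Inter>n. Y h n)" by blast
  qed
  ultimately have "LIP a 1 \<in> null_sets (perc p)" by (rule null_sets_subset[OF _ sets_LIP])
  thus ?thesis by (rule measure_eq_0_null_sets)
qed

section \<open>Zero-one law and symmetry\<close>

lemma above_mono: "(\<And>x. g x \<le> g' x) \<Longrightarrow> above g' \<subseteq> above g"
  unfolding above_def by (auto intro: le_less_trans)

lemma above_shift:
  "above (\<lambda>x. g x + m) = {\<omega>. \<omega> \<circ> (\<lambda>v. (fst v, snd v + m)) \<in> above g}"
proof (intro set_eqI iffI)
  fix \<omega> assume "\<omega> \<in> above (\<lambda>x. g x + m)"
  then obtain F where "lipschitz_int F" "\<And>x. \<omega> (x, F x)" "\<And>x. g x + m < F x"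
    unfolding above_def by blast
  thus "\<omega> \<in> {\<omega>. \<omega> \<circ> (\<lambda>v. (fst v, snd v + m)) \<in> above g}"
    unfolding above_def by (intro CollectI exI[of _ "\<lambda>x. F x - m"]) (simp add: lipschitz_int_def less_diff_eq)
next
  fix \<omega> assume "\<omega> \<in> {\<omega>. \<omega> \<circ> (\<lambda>v. (fst v, snd v + m)) \<in> above g}"
  then obtain F where "lipschitz_int F" "\<And>x. \<omega> (x, F x + m)" "\<And>x. g x < F x"
    unfolding above_def by auto
  thus "\<omega> \<in> above (\<lambda>x. g x + m)"
    unfolding above_def by (intro CollectI exI[of _ "\<lambda>x. F x + m"]) (simp add: lipschitz_int_def)
qed

lemma measure_above_shift: "measure (perc p) (above (\<lambda>x. g x + m)) = measure (perc p) (above g)"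
proof -
  have "bij (\<lambda>v :: int \<times> int. (fst v, snd v + m))"
    by (rule bij_betw_byWitness[where f'="\<lambda>v. (fst v, snd v - m)"]) auto
  thus ?thesis unfolding above_shift by (rule perc_permute_sites(2)[OF _ sets_above])
qed

text \<open>
  Raising the barrier by a constant does not change the probability of the event, so the event agrees
  in probability with the intersection \<open>E\<close> of the events for all raised barriers. The latter is a tail
  event: a barrier raised above a finite set forces the function to avoid that set.
\<close>

lemma above_zero_one: "measure (perc p) (above g) = 0 \<or> measure (perc p) (above g) = 1"
proof -
  interpret prob_space "perc p" by (rule prob_space_perc)
  define A where "A n = above (\<lambda>x. g x + int n)" for n
  define E where "E = (\<Inter>n. A n)"
  have setsE: "E \<in> sets (perc p)" unfolding E_def A_def by (auto intro: sets_above)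
  have "(\<lambda>n. prob (A n)) \<longlonglongrightarrow> prob E"
    unfolding E_def
  proof (rule finite_Lim_measure_decseq)
    show "decseq A" unfolding A_def by (intro decseq_SucI above_mono) simp
  qed (auto simp: A_def intro: sets_above)
  moreover have "prob (A n) = prob (above g)" for n by (simp add: A_def measure_above_shift)
  ultimately have "(\<lambda>n::nat. prob (above g)) \<longlonglongrightarrow> prob E" by simp
  hence eq: "prob E = prob (above g)" by (rule LIMSEQ_unique) (rule tendsto_const)
  have "prob E = 0 \<or> prob E = 1"
  proof (rule perc_zero_one[OF setsE])
    fix \<omega> \<omega>' :: config and S assume S: "finite S" "\<And>v. v \<notin> S \<Longrightarrow> \<omega> v = \<omega>' v" and \<omega>: "\<omega> \<in> E"
    have "\<omega>' \<in> A n" for n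
    proof -
      define N where "N = (\<Sum>v\<in>S. nat (snd v - g (fst v)))"
      define m where "m = n + N"
      have m: "snd v \<le> g (fst v) + int m" if "v \<in> S" for v
      proof -
        have "nat (snd v - g (fst v)) \<le> N"
          unfolding N_def using member_le_sum[OF that, of "\<lambda>v. nat (snd v - g (fst v))"] S(1) by simp
        thus ?thesis by (simp add: m_def)
      qed
      have "\<omega> \<in> A m" using \<omega> by (simp add: E_def)
      then obtain F where F: "lipschitz_int F" "\<And>x. \<omega> (x, F x)" "\<And>x. g x + int m < F x"
        unfolding A_def above_def by blast
      have "(x, F x) \<notin> S" for x using m[of "(x, F x)"] F(3)[of x] by auto
      hence "\<omega>' (x, F x)" for x using S(2) F(2) by metis
      moreover have "g x + int n < F x" for x using F(3)[of x] by (simp add: m_def)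
      ultimately show ?thesis using F(1) by (auto simp: A_def above_def)
    qed
    thus "\<omega>' \<in> E" by (simp add: E_def)
  qed
  thus ?thesis using eq by simp
qed

lemma measure_LIP_uminus: "measure (perc p) (LIP \<alpha> (- \<eta>)) = measure (perc p) (LIP \<alpha> \<eta>)"
proof -
  have sub: "\<omega> \<in> LIP \<alpha> (- \<eta>) \<Longrightarrow> \<omega> \<circ> (\<lambda>v. (- fst v, snd v)) \<in> LIP \<alpha> \<eta>" for \<omega> \<eta>
  proof -
    assume "\<omega> \<in> LIP \<alpha> (- \<eta>)"
    then obtain F where F: "lipschitz_int F" "\<And>x. \<omega> (x, F x)" "\<And>x. \<lfloor>\<alpha> * of_int (- \<eta>) * of_int x\<rfloor> < F x"
      unfolding LIP_def by blast
    have "lipschitz_int (\<lambda>x. F (- x))"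
      unfolding lipschitz_int_def
    proof (intro allI impI)
      fix x y :: int assume "\<bar>x - y\<bar> = 1"
      hence "\<bar>- x - - y\<bar> = 1" by simp
      thus "\<bar>F (- x) - F (- y)\<bar> \<le> 1" using F(1) unfolding lipschitz_int_def by blast
    qed
    thus "\<omega> \<circ> (\<lambda>v. (- fst v, snd v)) \<in> LIP \<alpha> \<eta>"
      unfolding LIP_def using F(2) F(3)[of "- _"] by (intro CollectI exI[of _ "\<lambda>x. F (- x)"]) simp
  qed
  have "\<omega> \<circ> (\<lambda>v. (- fst v, snd v)) \<circ> (\<lambda>v. (- fst v, snd v)) = \<omega>" for \<omega> :: config
    by (simp add: fun_eq_iff)
  hence eq: "LIP \<alpha> (- \<eta>) = {\<omega>. \<omega> \<circ> (\<lambda>v. (- fst v, snd v)) \<in> LIP \<alpha> \<eta>}"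
    using sub[of _ \<eta>] sub[of _ "- \<eta>"] by (metis (mono_tags, lifting) Collect_eqI Collect_mem_eq minus_minus)
  have "bij (\<lambda>v :: int \<times> int. (- fst v, snd v))"
    by (rule bij_betw_byWitness[where f'="\<lambda>v. (- fst v, snd v)"]) auto
  thus ?thesis unfolding eq by (rule perc_permute_sites(2)[OF _ sets_LIP])
qed

lemma measure_LIP_mono:
  assumes "0 \<le> p" "p \<le> p'" "p' \<le> 1"
  shows "measure (perc p) (LIP \<alpha> \<eta>) \<le> measure (perc p') (LIP \<alpha> \<eta>)"
  by (rule perc_mono[OF assms sets_LIP]) (auto simp: LIP_def)

section \<open>The critical probability\<close>

lemma is_critical_unique:
  assumes "is_critical \<alpha> pc" "is_critical \<alpha> pc'" shows "pc = pc'"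
proof -
  have "\<not> pc < pc'" if c: "is_critical \<alpha> pc" "is_critical \<alpha> pc'" for pc pc'
  proof
    assume "pc < pc'"
    then obtain p where "pc < p" "p < pc'" using dense by blast
    moreover have "p \<in> {0..1}" using c calculation by (auto simp: is_critical_def)
    ultimately have "measure (perc p) (LIP \<alpha> 1) = 1" "measure (perc p) (LIP \<alpha> 1) = 0"
      using c unfolding is_critical_def by blast+
    thus False by simp
  qed
  from this[OF assms] this[OF assms(2,1)] show ?thesis by simp
qed

text \<open>
  By monotonicity and the zero-one law, the supremum of the parameters of probability 0 is
  critical as soon as it lies strictly between 0 and 1.
\<close>

lemma p_L_bounds:
  assumes a: "0 < a" "a < 1" and p1: "p1 < 1" "0 \<le> p1" "measure (perc p1) (LIP a 1) = 1"
  shows "a \<le> p_L a" "p_L a \<le> p1"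
proof -
  define Z where "Z = {p \<in> {0..1}. measure (perc p) (LIP a 1) = 0}"
  define pc where "pc = Sup Z"
  have le1: "measure (perc p) E \<le> 1" for p E
    using prob_space.prob_le_1[OF prob_space_perc] .
  have Zle: "p \<le> p1" if "p \<in> Z" for p
  proof (rule ccontr)
    assume "\<not> p \<le> p1"
    hence "1 \<le> measure (perc p) (LIP a 1)" using measure_LIP_mono[of p1 p a 1] that p1 by (auto simp: Z_def)
    thus False using that by (simp add: Z_def)
  qed
  have bdd: "bdd_above Z" using Zle by (meson bdd_aboveI)
  have small: "p \<in> Z" if "0 \<le> p" "p < a" for p using that a LIP_eq_0[of p a] by (auto simp: Z_def)
  hence ne: "Z \<noteq> {}" using a by (metis empty_iff order_refl)
  have "a \<le> pc"
  proof (rule dense_le_bounded[of 0 a])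
    fix p assume "0 < p" "p < a"
    thus "p \<le> pc" unfolding pc_def by (intro cSup_upper small bdd) auto
  qed (use a in simp)
  moreover have "pc \<le> p1" unfolding pc_def by (rule cSup_least[OF ne Zle])
  moreover have "is_critical a pc"
    unfolding is_critical_def
  proof (intro conjI ballI impI)
    show "0 < pc" "pc < 1" using calculation a p1 by auto
    fix \<eta> :: int and p :: real assume \<eta>: "\<eta> \<in> {- 1, 1}" and p: "p \<in> {0..1}"
    have eq: "measure (perc p) (LIP a \<eta>) = measure (perc p) (LIP a 1)"
      using \<eta> measure_LIP_uminus[of p a 1] by auto
    show "measure (perc p) (LIP a \<eta>) = 0" if lt: "p < pc"
    proof -
      obtain p' where p': "p' \<in> Z" "p < p'"
        using lt less_cSup_iff[OF ne bdd, of p] by (auto simp: pc_def)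
      hence "measure (perc p) (LIP a 1) \<le> 0" using measure_LIP_mono[of p p' a 1] p by (auto simp: Z_def)
      thus ?thesis using measure_nonneg[of "perc p" "LIP a 1"] eq by linarith
    qed
    show "measure (perc p) (LIP a \<eta>) = 1" if "pc < p"
    proof -
      have "p \<notin> Z" using that cSup_upper[OF _ bdd, of p] unfolding pc_def by auto
      thus ?thesis using above_zero_one p eq unfolding LIP_eq_above by (auto simp: Z_def LIP_eq_above)
    qed
  qed
  ultimately show "a \<le> p_L a" "p_L a \<le> p1"
    unfolding p_L_def using is_critical_unique[of a] by (metis the_equality)+
qed

text \<open>
  With \<open>\<delta> = 1 - a\<close> and \<open>1 - p = c * \<delta>\<close>, the tilt \<open>z = 1 / c\<close> turns the condition of \<open>LIP_eq_1\<close> to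
  leading order into \<open>1 - c < ln (1 / c)\<close>, which holds for every \<open>c < 1\<close>. The margin \<open>\<kappa>\<close> absorbs
  the contribution of the longer excursions, which is of order \<open>\<delta> * sqrt \<delta>\<close>.
\<close>

lemma LIP_eq_1_near:
  assumes c: "0 < c" "c < 1"
  shows "eventually (\<lambda>a. measure (perc (1 - c * (1 - a))) (LIP a 1) = 1) (at_left 1)"
proof -
  define \<kappa> where "\<kappa> = ln (1 / c) - (1 - c)"
  have "ln c \<noteq> c - 1" using ln_eq_minus_one[of c] c by auto
  hence "0 < \<kappa>" using ln_le_minus_one[of c] c by (simp add: \<kappa>_def ln_div)
  define d where "d = min (1 / 36) ((\<kappa> / 18) ^ 2)"
  have "0 < d" using \<open>0 < \<kappa>\<close> by (simp add: d_def)
  have "measure (perc (1 - c * (1 - a))) (LIP a 1) = 1" if a: "1 - d < a" "a < 1" for a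
  proof -
    define \<delta> where "\<delta> = 1 - a"
    have \<delta>: "0 < \<delta>" "\<delta> < 1 / 36" "\<delta> < (\<kappa> / 18) ^ 2" using a by (auto simp: \<delta>_def d_def)
    define y where "y = sqrt \<delta>"
    have y: "0 < y" "y ^ 2 = \<delta>" using \<delta> by (auto simp: y_def)
    have "y < 1 / 6" using \<delta>(2) unfolding y_def by (intro real_less_lsqrt) (auto simp: power2_eq_square)
    have "y < \<kappa> / 18" using \<delta>(3) \<open>0 < \<kappa>\<close> unfolding y_def by (intro real_less_lsqrt) auto
    have c\<delta>: "0 \<le> c * \<delta>" "c * \<delta> \<le> 1" using c \<delta> by (auto intro!: mult_le_one)
    have "(1 - c * \<delta>) * (1 + y ^ 2 + 18 * y ^ 3) < (1 / c) powr \<delta>"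
    proof -
      have "(1 - c * \<delta>) * (1 + y ^ 2 + 18 * y ^ 3) = 1 + \<delta> * (1 - c + 18 * y) - c * \<delta> * (y ^ 2 + 18 * y ^ 3)"
        using y(2) by (simp add: power3_eq_cube power2_eq_square algebra_simps)
      also have "\<dots> \<le> 1 + \<delta> * (1 - c + 18 * y)" using c\<delta> y \<delta> by simp
      also have "\<dots> < 1 + \<delta> * ln (1 / c)" using \<delta> \<open>y < \<kappa> / 18\<close> by (simp add: \<kappa>_def)
      also have "\<dots> \<le> exp (\<delta> * ln (1 / c))" by (rule exp_ge_add_one_self)
      also have "\<dots> = (1 / c) powr \<delta>" using c by (simp add: powr_def)
      finally show ?thesis .
    qed
    moreover have "0 < (1 / c) powr \<delta>" using c by simp
    moreover have "(1 / c) powr (a - 1) = 1 / (1 / c) powr \<delta>"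
      using powr_minus_divide[of "1 / c" \<delta>] by (simp add: \<delta>_def)
    ultimately have "(1 - c * \<delta>) * (1 / c) powr (a - 1) * (1 + y ^ 2 + 18 * y ^ 3) < 1"
      by (simp add: pos_divide_less_eq)
    thus ?thesis
      using LIP_eq_1[of "1 - c * \<delta>" "1 / c" y a] c c\<delta> y \<open>y < 1 / 6\<close> a \<delta> by (simp add: \<delta>_def)
  qed
  thus ?thesis using \<open>0 < d\<close> by (intro eventually_at_leftI[of "1 - d"]) auto
qed

lemma q_L_bounds:
  assumes c: "0 < c" "c < 1"
  shows "eventually (\<lambda>a. c \<le> q_L a / (1 - a) \<and> q_L a / (1 - a) \<le> 1) (at_left 1)"
proof -
  have "eventually (\<lambda>a::real. 0 < a) (at_left 1)" "eventually (\<lambda>a::real. a < 1) (at_left 1)"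
    by (auto intro: eventually_at_leftI[of 0])
  with LIP_eq_1_near[OF c] show ?thesis
  proof eventually_elim
    case (elim a)
    have "c * (1 - a) \<le> 1" "0 < c * (1 - a)" using c elim by (auto intro!: mult_le_one)
    hence "a \<le> p_L a" "p_L a \<le> 1 - c * (1 - a)"
      using p_L_bounds[of a "1 - c * (1 - a)"] elim by auto
    thus ?case using elim by (simp add: q_L_def pos_le_divide_eq pos_divide_le_eq)
  qed
qed

theorem proposition3p5:
  shows "asymp_ge (at_left 1) q_L (\<lambda>\<alpha>. 1 - \<alpha>) \<and> q_L \<sim>[at_left 1] (\<lambda>\<alpha>. 1 - \<alpha>)"
proof
  have lim: "((\<lambda>a. q_L a / (1 - a)) \<longlongrightarrow> 1) (at_left 1)"
  proof (rule order_tendstoI)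
    fix l :: real assume "l < 1"
    then obtain c where c: "max l 0 < c" "c < 1" using dense[of "max l 0" 1] by auto
    show "eventually (\<lambda>a. l < q_L a / (1 - a)) (at_left 1)"
      using q_L_bounds[of c] c by (auto elim!: eventually_mono)
  next
    fix u :: real assume "1 < u"
    thus "eventually (\<lambda>a. q_L a / (1 - a) < u) (at_left 1)"
      using q_L_bounds[of "1 / 2"] by (auto elim!: eventually_mono)
  qed
  thus "q_L \<sim>[at_left 1] (\<lambda>\<alpha>. 1 - \<alpha>)" by (rule asymp_equivI')
  have "((\<lambda>a. ereal (q_L a / (1 - a))) \<longlongrightarrow> ereal 1) (at_left 1)" using lim by (rule tendsto_ereal)
  hence "Liminf (at_left 1) (\<lambda>a. ereal (q_L a / (1 - a))) = ereal 1"
    by (intro lim_imp_Liminf) auto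
  thus "asymp_ge (at_left 1) q_L (\<lambda>\<alpha>. 1 - \<alpha>)" by (simp add: asymp_ge_def one_ereal_def)
qed

end
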